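(* There is a constant $C$ such that for all $f,g\in C^1[0,1]$ and all integers $n\ge 1$ ($C$ being independent of $n,f,g$ and $x$), $$\begin{aligned}\left\|K_n(fg)-K_nf\cdot K_ng-\frac{X}{n}f'g'\right\|_\infty\le \frac{C}{n}\Big\{&\omega_3\big(f',n^{-1/6}\big)\,\omega_3\big(g',n^{-1/6}\big)+\|f'\|_\infty\,\omega_3\big(g',n^{-1/6}\big)+\|g'\|_\infty\,\omega_3\big(f',n^{-1/6}\big)\\&+\max\Big\{\frac{\|f'\|_\infty}{n^{1/2}},\,\omega_3\big(f',n^{-1/6}\big)\Big\}\,\max\Big\{\frac{\|g'\|_\infty}{n^{1/2}},\,\omega_3\big(g',n^{-1/6}\big)\Big\}\Big\},\end{aligned}$$ where $X=X(x)=x(1-x)$, $x\in[0,1]$.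
   Context: For $n\ge 1$, the classical Kantorovich operator is $$K_n(f;x)=(n+1)\sum_{k=0}^n p_{n,k}(x)\int_{k/(n+1)}^{(k+1)/(n+1)}f(t)\,dt,\qquad p_{n,k}(x)=\binom nk x^k(1-x)^{n-k},\quad x\in[0,1],$$ and $K_nf$ denotes the function $x\mapsto K_n(f;x)$. Functions are real-valued, and $\|\cdot\|_\infty$ is the supremum norm on $[0,1]$. For $g\in C[0,1]$, $k\in\mathbb N$ and $t\ge 0$, the classical $k$-th order modulus of smoothness is $$\omega_k(g,t)=\sup\left\{\left|\sum_{j=0}^k(-1)^{k-j}\binom kj g(x+j\delta)\right| : 0\le\delta\le t,\ x,\,x+k\delta\in[0,1]\right\}.$$ *)

theory Defs
  imports "HOL-Analysis.Analysis"
begin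

definition kantorovich :: "nat \<Rightarrow> (real \<Rightarrow> real) \<Rightarrow> real \<Rightarrow> real" where
  "kantorovich n f x =
     (real n + 1) * (\<Sum>k\<le>n. Bernstein n k x *
        integral {real k / (real n + 1) .. (real k + 1) / (real n + 1)} f)"

text \<open>Meaningful only for functions bounded on the unit interval, as \<open>Sup\<close> on the reals is
  unspecified for unbounded sets.\<close>

definition sup_norm01 :: "(real \<Rightarrow> real) \<Rightarrow> real" where
  "sup_norm01 f = (SUP x\<in>{0..1}. \<bar>f x\<bar>)"

definition modulus_of_smoothness :: "nat \<Rightarrow> (real \<Rightarrow> real) \<Rightarrow> real \<Rightarrow> real" where
  "modulus_of_smoothness k g t =
     Sup {\<bar>\<Sum>j\<le>k. (- 1) ^ (k - j) * real (k choose j) * g (x + real j * \<delta>)\<bar> | x \<delta>.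
          0 \<le> \<delta> \<and> \<delta> \<le> t \<and> x \<in> {0..1} \<and> x + real k * \<delta> \<in> {0..1}}"

text \<open>\<open>f\<close> is in $C^1[0,1]$ with derivative \<open>f'\<close>; at the endpoints the derivative is one-sided, and
  nothing is assumed about \<open>f\<close> outside the unit interval. (The library's
  \<open>C1_differentiable_on\<close> would demand two-sided derivatives at 0 and 1.)\<close>

definition C1_01_with_deriv :: "(real \<Rightarrow> real) \<Rightarrow> (real \<Rightarrow> real) \<Rightarrow> bool" where
  "C1_01_with_deriv f f' \<longleftrightarrow>
     (\<forall>x\<in>{0..1}. (f has_real_derivative f' x) (at x within {0..1})) \<and> continuous_on {0..1} f'"

end

theory Submission
  imports Defs
begin

text \<open>
  For fixed \<open>n\<close> and \<open>x\<close> the functional \<open>f \<mapsto> kantorovich n f x\<close> is an expectation: it is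
  linear, monotone and preserves constants. The quantity to be estimated is therefore a covariance,
  \<open>cov f g = K(fg) - K f * K g\<close>, in which constants drop out and which is bilinear.

  Write \<open>e t = t - x\<close> and expand \<open>f = f x + f' x * e + S\<close>, and \<open>g\<close> in the same way with a
  remainder \<open>T\<close>. Then \<open>cov f g\<close> equals
  \<open>f' x * g' x * cov e e + f' x * cov e T + g' x * cov S e + cov S T\<close>. The first term is the
  claimed main term: \<open>cov e e\<close> differs from \<open>x (1 - x) / n\<close> by at most \<open>1 / n\<^sup>2\<close>.

  The remainders are controlled by a local linear approximation of the derivative. Let \<open>m\<close> be the
  norm of \<open>f'\<close>, let \<open>W\<close> be its third modulus at step \<open>h\<close>, and let \<open>M = m + W / h\<^sup>3\<close>. For every
  \<open>x\<close> there is a slope \<open>b\<close> of size \<open>O(M)\<close> with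
  \<open>f' t = f' x + b * (t - x) + O(W + M * (t - x)\<^sup>2)\<close> (lemma \<open>linear_approximation\<close>). To see
  this, replace \<open>f'\<close> by a Steklov mean \<open>F\<close>, which is within \<open>W\<close> of \<open>f'\<close> and has a third
  derivative of size \<open>O(W / h\<^sup>3)\<close>; bounds on \<open>F\<close> and on its third derivative give bounds on the
  derivatives in between, and \<open>b\<close> is the derivative of \<open>F\<close> at \<open>x\<close>.

  Integration yields \<open>S = (b / 2) * e\<^sup>2 + R\<close> with \<open>R = O(W |e| + M |e|\<^sup>3)\<close>. The quadratic term
  matters only through \<open>cov e (e\<^sup>2)\<close>, which is \<open>O(1 / n\<^sup>2)\<close> because the third central moment is of
  that order; estimating it by absolute values would only give \<open>O(n powr (- 3 / 2))\<close>. As the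
  second and fourth central moments are \<open>O(1 / n)\<close> and \<open>O(1 / n\<^sup>2)\<close>, this gives
  \<open>cov e S = O(W / n + M / n\<^sup>2)\<close>, and \<open>cov S T\<close> is \<open>O(1 / n)\<close> times the product of the numbers
  \<open>W + M / sqrt n\<close> belonging to \<open>f\<close> and \<open>g\<close>.

  The step \<open>h = n powr (- 1 / 6)\<close> is the one for which \<open>W / h\<^sup>3 = W * sqrt n\<close>. Then
  \<open>W + M / sqrt n\<close> is comparable with the maximum of \<open>m / sqrt n\<close> and \<open>W\<close>, so \<open>cov S T\<close>
  produces the product of maxima on the right-hand side, and the other terms produce the mixed ones.
\<close>

section \<open>Third differences and mean values\<close>

definition third_difference :: "(real \<Rightarrow> real) \<Rightarrow> real \<Rightarrow> real \<Rightarrow> real" where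
  "third_difference g d y = g (y + 3 * d) - 3 * g (y + 2 * d) + 3 * g (y + d) - g y"

lemma second_difference_MVT:
  fixes G :: "real \<Rightarrow> real"
  assumes "0 < d"
    and G: "\<And>u. y \<le> u \<Longrightarrow> u \<le> y + 2 * d \<Longrightarrow> (G has_real_derivative G1 u) (at u)"
    and G1: "\<And>u. y \<le> u \<Longrightarrow> u \<le> y + 2 * d \<Longrightarrow> (G1 has_real_derivative G2 u) (at u)"
  shows "\<exists>\<xi>. y < \<xi> \<and> \<xi> < y + 2 * d \<and> G (y + 2 * d) - 2 * G (y + d) + G y = d\<^sup>2 * G2 \<xi>"
proof -
  have "\<exists>z. y < z \<and> z < y + d \<and>
      (G (y + d + d) - G (y + d)) - (G (y + d) - G y) = (y + d - y) * (G1 (z + d) - G1 z)"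
  proof (rule MVT2)
    show "y < y + d" using \<open>0 < d\<close> by simp
    fix u assume u: "y \<le> u" "u \<le> y + d"
    have "((\<lambda>u. G (u + d)) has_real_derivative G1 (u + d)) (at u)"
      using G[of "u + d"] u \<open>0 < d\<close> by (simp add: DERIV_shift)
    then show "((\<lambda>u. G (u + d) - G u) has_real_derivative G1 (u + d) - G1 u) (at u)"
      using G[of u] u \<open>0 < d\<close> by (intro DERIV_diff) auto
  qed
  then obtain z where z: "y < z" "z < y + d"
    and 1: "(G (y + d + d) - G (y + d)) - (G (y + d) - G y) = d * (G1 (z + d) - G1 z)"
    by auto
  have "\<exists>\<xi>. z < \<xi> \<and> \<xi> < z + d \<and> G1 (z + d) - G1 z = (z + d - z) * G2 \<xi>"
    using \<open>0 < d\<close> z by (intro MVT2 G1) auto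
  then obtain \<xi> where \<xi>: "z < \<xi>" "\<xi> < z + d" and 2: "G1 (z + d) - G1 z = d * G2 \<xi>"
    by auto
  have "y + d + d = y + 2 * d" by simp
  from 1[unfolded this] have "G (y + 2 * d) - 2 * G (y + d) + G y = d\<^sup>2 * G2 \<xi>"
    unfolding 2 by (simp add: power2_eq_square)
  then show ?thesis using z \<xi> by (intro exI[of _ \<xi>]) auto
qed

lemma third_difference_MVT:
  fixes A :: "real \<Rightarrow> real"
  assumes "0 < d"
    and A: "\<And>u. y \<le> u \<Longrightarrow> u \<le> y + 3 * d \<Longrightarrow> (A has_real_derivative A1 u) (at u)"
    and A1: "\<And>u. y \<le> u \<Longrightarrow> u \<le> y + 3 * d \<Longrightarrow> (A1 has_real_derivative A2 u) (at u)"
    and A2: "\<And>u. y \<le> u \<Longrightarrow> u \<le> y + 3 * d \<Longrightarrow> (A2 has_real_derivative A3 u) (at u)"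
  shows "\<exists>\<xi>. y < \<xi> \<and> \<xi> < y + 3 * d \<and> third_difference A d y = d ^ 3 * A3 \<xi>"
proof -
  have "\<exists>\<xi>. y < \<xi> \<and> \<xi> < y + 2 * d \<and>
      (A (y + 2 * d + d) - A (y + 2 * d)) - 2 * (A (y + d + d) - A (y + d)) + (A (y + d) - A y)
      = d\<^sup>2 * (A2 (\<xi> + d) - A2 \<xi>)"
  proof (rule second_difference_MVT[OF \<open>0 < d\<close>])
    fix u assume u: "y \<le> u" "u \<le> y + 2 * d"
    have "((\<lambda>u. A (u + d)) has_real_derivative A1 (u + d)) (at u)"
      "((\<lambda>u. A1 (u + d)) has_real_derivative A2 (u + d)) (at u)"
      using A[of "u + d"] A1[of "u + d"] u \<open>0 < d\<close> by (simp_all add: DERIV_shift)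
    then show "((\<lambda>u. A (u + d) - A u) has_real_derivative A1 (u + d) - A1 u) (at u)"
      "((\<lambda>u. A1 (u + d) - A1 u) has_real_derivative A2 (u + d) - A2 u) (at u)"
      using A[of u] A1[of u] u \<open>0 < d\<close> by (auto intro!: DERIV_diff)
  qed
  then obtain z where z: "y < z" "z < y + 2 * d" and
    1: "(A (y + 2 * d + d) - A (y + 2 * d)) - 2 * (A (y + d + d) - A (y + d)) + (A (y + d) - A y)
      = d\<^sup>2 * (A2 (z + d) - A2 z)"
    by blast
  have "\<exists>\<xi>. z < \<xi> \<and> \<xi> < z + d \<and> A2 (z + d) - A2 z = (z + d - z) * A3 \<xi>"
    using \<open>0 < d\<close> z by (intro MVT2 A2) auto
  then obtain \<xi> where \<xi>: "z < \<xi>" "\<xi> < z + d" and 2: "A2 (z + d) - A2 z = d * A3 \<xi>"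
    by auto
  have "y + d + d = y + 2 * d" "y + 2 * d + d = y + 3 * d" by simp_all
  from 1[unfolded this] have "third_difference A d y = d ^ 3 * A3 \<xi>"
    unfolding 2 by (simp add: power2_eq_square power3_eq_cube third_difference_def)
  then show ?thesis using z \<xi> by (intro exI[of _ \<xi>]) auto
qed

section \<open>Smoothing and local linear approximation\<close>

text \<open>
  Extending \<open>\<phi>\<close> by constants beyond the unit interval turns the end points into interior points, so
  that the derivatives there are two-sided and the mean value theorems apply without exceptions.
\<close>

lemma third_antiderivative:
  fixes \<phi> :: "real \<Rightarrow> real"
  assumes "continuous_on {0..1} \<phi>"
  obtains P1 P2 P3 where
    "\<And>u. 0 \<le> u \<Longrightarrow> u \<le> 1 \<Longrightarrow> (P3 has_real_derivative P2 u) (at u)"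
    "\<And>u. 0 \<le> u \<Longrightarrow> u \<le> 1 \<Longrightarrow> (P2 has_real_derivative P1 u) (at u)"
    "\<And>u. 0 \<le> u \<Longrightarrow> u \<le> 1 \<Longrightarrow> (P1 has_real_derivative \<phi> u) (at u)"
proof -
  have prim: "\<exists>P. \<forall>u\<in>{-1..2}. (P has_real_derivative g u) (at u within {-1..2})"
    if "continuous_on {-1..2} g" for g :: "real \<Rightarrow> real"
    using antiderivative_continuous[OF that]
    by (metis has_real_derivative_iff_has_vector_derivative)
  define \<phi>' where "\<phi>' u = \<phi> (max 0 (min 1 u))" for u
  have c0: "continuous_on {-1..2} \<phi>'"
    unfolding \<phi>'_def by (intro continuous_on_compose2[OF assms] continuous_intros) auto
  obtain P1 where P1: "\<forall>u\<in>{-1..2}. (P1 has_real_derivative \<phi>' u) (at u within {-1..2})"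
    using prim[OF c0] by blast
  have c1: "continuous_on {-1..2} P1" using P1 DERIV_continuous_on by blast
  obtain P2 where P2: "\<forall>u\<in>{-1..2}. (P2 has_real_derivative P1 u) (at u within {-1..2})"
    using prim[OF c1] by blast
  have c2: "continuous_on {-1..2} P2" using P2 DERIV_continuous_on by blast
  obtain P3 where P3: "\<forall>u\<in>{-1..2}. (P3 has_real_derivative P2 u) (at u within {-1..2})"
    using prim[OF c2] by blast
  have at: "at u within {-1..2} = at u" if "0 \<le> u" "u \<le> 1" for u :: real
    using that by (intro at_within_interior) auto
  have eq: "\<phi>' u = \<phi> u" if "0 \<le> u" "u \<le> 1" for u
    using that by (simp add: \<phi>'_def)
  show thesis
  proof (rule that[of P3 P2 P1])
    fix u :: real assume u: "0 \<le> u" "u \<le> 1"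
    then have "u \<in> {-1..2}" by simp
    with P1 P2 P3 show "(P3 has_real_derivative P2 u) (at u)" "(P2 has_real_derivative P1 u) (at u)"
      "(P1 has_real_derivative \<phi> u) (at u)"
      using at[OF u] eq[OF u] by force+
  qed
qed

text \<open>
  Averaging the third difference \<open>\<phi>(y + 3s) - 3\<phi>(y + 2s) + 3\<phi>(y + s) - \<phi> y\<close> over
  \<open>s = u + v + w\<close> with \<open>u, v, w\<close> in \<open>[0, \<eta>]\<close>, and moving \<open>\<phi> y\<close> to the other side, gives the
  Steklov mean \<open>F\<close>. It is a one-sided mean, looking to the right; this is why \<open>y\<close> has to stay away
  from the right end point. In terms of a third primitive \<open>P3\<close> the average of \<open>\<phi>(y + js)\<close> is the
  third difference of \<open>P3\<close> with step \<open>j\<eta>\<close> divided by \<open>(j\<eta>)\<^sup>3\<close>, so that differentiating \<open>F\<close>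
  only replaces \<open>P3\<close> by \<open>P2\<close>, \<open>P1\<close> and \<open>\<phi>\<close>, and the third derivative is a combination of third
  differences of \<open>\<phi>\<close>.
\<close>

lemma third_order_smoothing:
  fixes \<phi> :: "real \<Rightarrow> real"
  assumes cont: "continuous_on {0..1} \<phi>" and \<eta>: "0 < \<eta>" "9 * \<eta> \<le> 1 / 4"
    and W: "\<And>y s. 0 \<le> s \<Longrightarrow> s \<le> 3 * \<eta> \<Longrightarrow> 0 \<le> y \<Longrightarrow> y + 3 * s \<le> 1 \<Longrightarrow>
              \<bar>third_difference \<phi> s y\<bar> \<le> W"
  obtains F F1 F2 F3 where
    "\<And>y. 0 \<le> y \<Longrightarrow> y \<le> 3 / 4 \<Longrightarrow> (F has_real_derivative F1 y) (at y)"
    "\<And>y. 0 \<le> y \<Longrightarrow> y \<le> 3 / 4 \<Longrightarrow> (F1 has_real_derivative F2 y) (at y)"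
    "\<And>y. 0 \<le> y \<Longrightarrow> y \<le> 3 / 4 \<Longrightarrow> (F2 has_real_derivative F3 y) (at y)"
    "\<And>y. 0 \<le> y \<Longrightarrow> y \<le> 3 / 4 \<Longrightarrow> \<bar>F y - \<phi> y\<bar> \<le> W"
    "\<And>y. 0 \<le> y \<Longrightarrow> y \<le> 3 / 4 \<Longrightarrow> \<bar>F3 y\<bar> \<le> 4 * W / \<eta> ^ 3"
proof -
  obtain P1 P2 P3 where
    P3: "\<And>u. 0 \<le> u \<Longrightarrow> u \<le> 1 \<Longrightarrow> (P3 has_real_derivative P2 u) (at u)" and
    P2: "\<And>u. 0 \<le> u \<Longrightarrow> u \<le> 1 \<Longrightarrow> (P2 has_real_derivative P1 u) (at u)" and
    P1: "\<And>u. 0 \<le> u \<Longrightarrow> u \<le> 1 \<Longrightarrow> (P1 has_real_derivative \<phi> u) (at u)"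
    using third_antiderivative[OF cont] by metis
  \<comment> \<open>The weights \<open>3, - 3 / 8, 1 / 27\<close> are the coefficients \<open>3, - 3, 1\<close> of the third difference
    divided by the cubes of the step multiples \<open>1, 2, 3\<close>.\<close>
  define S where "S P y = (3 * third_difference P \<eta> y - 3 / 8 * third_difference P (2 * \<eta>) y
      + 1 / 27 * third_difference P (3 * \<eta>) y) / \<eta> ^ 3" for P y
  have deriv_S: "(S P has_real_derivative S Q y) (at y)"
    if "0 \<le> y" "y \<le> 3 / 4"
      and PQ: "\<And>u. 0 \<le> u \<Longrightarrow> u \<le> 1 \<Longrightarrow> (P has_real_derivative Q u) (at u)" for P Q y
  proof -
    have shift: "((\<lambda>y. P (y + c)) has_real_derivative Q (y + c)) (at y)" if "0 \<le> c" "c \<le> 9 * \<eta>" for c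
      using PQ[of "y + c"] that \<open>0 \<le> y\<close> \<open>y \<le> 3 / 4\<close> \<eta> by (simp add: DERIV_shift)
    have diff: "((\<lambda>y. third_difference P d y) has_real_derivative third_difference Q d y) (at y)"
      if "0 \<le> d" "d \<le> 3 * \<eta>" for d
      unfolding third_difference_def using that shift[of "3 * d"] shift[of "2 * d"] shift[of d] shift[of 0] \<eta>
      by (intro DERIV_diff DERIV_add DERIV_cmult) auto
    show ?thesis
      unfolding S_def[abs_def] using \<eta>
      by (intro DERIV_cdivide DERIV_diff DERIV_add DERIV_cmult diff) auto
  qed
  have close: "\<bar>S P3 y - \<phi> y\<bar> \<le> W" if y: "0 \<le> y" "y \<le> 3 / 4" for y
  proof -
    have comp: "((\<lambda>s. P (y + c * s)) has_real_derivative c * Q (y + c * s)) (at s)"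
      if "0 \<le> s" "s \<le> 3 * \<eta>" "c \<in> {1, 2, 3}"
        and PQ: "\<And>u. 0 \<le> u \<Longrightarrow> u \<le> 1 \<Longrightarrow> (P has_real_derivative Q u) (at u)" for P Q s c
    proof -
      have "(P has_real_derivative Q (y + c * s)) (at (y + c * s))"
        using that y \<eta> by (intro PQ) auto
      moreover have "((\<lambda>s. y + c * s) has_real_derivative c) (at s)"
        by (auto intro!: derivative_eq_intros)
      ultimately show ?thesis
        using DERIV_chain2[of P "Q (y + c * s)" "\<lambda>s. y + c * s" s c UNIV] by (simp add: mult.commute)
    qed
    \<comment> \<open>As a function of the step, \<open>\<eta>\<^sup>3 F y\<close> is itself a third difference, and the third
      derivative of the differenced function at \<open>s\<close> is \<open>\<phi> y\<close> plus the third difference of \<open>\<phi>\<close>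
      with step \<open>s\<close>. This replaces the triple integral by a mean value.\<close>
    define A where "A = (\<lambda>s. 3 * P3 (y + 1 * s) - 3 / 8 * P3 (y + 2 * s) + 1 / 27 * P3 (y + 3 * s))"
    have "\<exists>\<xi>. 0 < \<xi> \<and> \<xi> < 0 + 3 * \<eta> \<and> third_difference A \<eta> 0
        = \<eta> ^ 3 * (3 * (1 * (1 * (1 * \<phi> (y + 1 * \<xi>)))) - 3 / 8 * (2 * (2 * (2 * \<phi> (y + 2 * \<xi>))))
                + 1 / 27 * (3 * (3 * (3 * \<phi> (y + 3 * \<xi>)))))"
    proof (rule third_difference_MVT[OF \<eta>(1)])
      fix s :: real assume "0 \<le> s" "s \<le> 0 + 3 * \<eta>"
      then have s: "0 \<le> s" "s \<le> 3 * \<eta>" by auto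
      show "(A has_real_derivative 3 * (1 * P2 (y + 1 * s)) - 3 / 8 * (2 * P2 (y + 2 * s))
                + 1 / 27 * (3 * P2 (y + 3 * s))) (at s)"
        unfolding A_def
        by (intro DERIV_diff DERIV_add DERIV_cmult comp[OF s _ P3]) auto
      show "((\<lambda>s. 3 * (1 * P2 (y + 1 * s)) - 3 / 8 * (2 * P2 (y + 2 * s))
                + 1 / 27 * (3 * P2 (y + 3 * s))) has_real_derivative
              3 * (1 * (1 * P1 (y + 1 * s))) - 3 / 8 * (2 * (2 * P1 (y + 2 * s)))
                + 1 / 27 * (3 * (3 * P1 (y + 3 * s)))) (at s)"
        by (intro DERIV_diff DERIV_add DERIV_cmult comp[OF s _ P2]) auto
      show "((\<lambda>s. 3 * (1 * (1 * P1 (y + 1 * s))) - 3 / 8 * (2 * (2 * P1 (y + 2 * s)))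
                + 1 / 27 * (3 * (3 * P1 (y + 3 * s)))) has_real_derivative
              3 * (1 * (1 * (1 * \<phi> (y + 1 * s)))) - 3 / 8 * (2 * (2 * (2 * \<phi> (y + 2 * s))))
                + 1 / 27 * (3 * (3 * (3 * \<phi> (y + 3 * s))))) (at s)"
        by (intro DERIV_diff DERIV_add DERIV_cmult comp[OF s _ P1]) auto
    qed
    then obtain \<xi> where \<xi>: "0 < \<xi>" "\<xi> < 3 * \<eta>" and eq: "third_difference A \<eta> 0
        = \<eta> ^ 3 * (third_difference \<phi> \<xi> y + \<phi> y)"
      by (auto simp: third_difference_def algebra_simps)
    have "\<eta> ^ 3 * S P3 y = 3 * third_difference P3 \<eta> y - 3 / 8 * third_difference P3 (2 * \<eta>) y
        + 1 / 27 * third_difference P3 (3 * \<eta>) y"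
      using \<eta> by (simp add: S_def)
    also have "\<dots> = third_difference A \<eta> 0"
      by (simp add: A_def third_difference_def algebra_simps)
    finally have "third_difference A \<eta> 0 = \<eta> ^ 3 * S P3 y" ..
    with eq have "S P3 y = third_difference \<phi> \<xi> y + \<phi> y"
      using \<eta> by simp
    then show ?thesis using W[of \<xi> y] \<xi> y \<eta> by auto
  qed
  have bound: "\<bar>S \<phi> y\<bar> \<le> 4 * W / \<eta> ^ 3" if y: "0 \<le> y" "y \<le> 3 / 4" for y
  proof -
    have "\<bar>3 * third_difference \<phi> \<eta> y - 3 / 8 * third_difference \<phi> (2 * \<eta>) y
      + 1 / 27 * third_difference \<phi> (3 * \<eta>) y\<bar> \<le> 4 * W"
      using W[of \<eta> y] W[of "2 * \<eta>" y] W[of "3 * \<eta>" y] y \<eta> by auto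
    then show ?thesis using \<eta> by (simp add: S_def divide_right_mono)
  qed
  show thesis
    by (rule that[of "S P3" "S P2" "S P1" "S \<phi>"]) (auto intro: deriv_S P1 P2 P3 close bound)
qed

text \<open>
  An interpolation inequality of Landau-Kolmogorov type. A difference quotient of \<open>F\<close> at fixed points
  equals a derivative of \<open>F\<close> at some point, where that derivative is thus bounded by a multiple of
  \<open>M\<close>; a bound on the next derivative carries this to every point of the interval.
\<close>

lemma intermediate_derivative_bounds:
  fixes F :: "real \<Rightarrow> real"
  assumes F: "\<And>y. 0 \<le> y \<Longrightarrow> y \<le> 3 / 4 \<Longrightarrow> (F has_real_derivative F1 y) (at y)"
    and F1: "\<And>y. 0 \<le> y \<Longrightarrow> y \<le> 3 / 4 \<Longrightarrow> (F1 has_real_derivative F2 y) (at y)"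
    and F2: "\<And>y. 0 \<le> y \<Longrightarrow> y \<le> 3 / 4 \<Longrightarrow> (F2 has_real_derivative F3 y) (at y)"
    and M: "\<And>y. 0 \<le> y \<Longrightarrow> y \<le> 3 / 4 \<Longrightarrow> \<bar>F y\<bar> \<le> M"
    and Q: "\<And>y. 0 \<le> y \<Longrightarrow> y \<le> 3 / 4 \<Longrightarrow> \<bar>F3 y\<bar> \<le> Q"
    and y: "0 \<le> y" "y \<le> 3 / 4"
  shows "\<bar>F2 y\<bar> \<le> 64 * M + Q" "\<bar>F1 y\<bar> \<le> 68 * M + Q"
proof -
  have lip: "\<bar>g u - g v\<bar> \<le> B"
    if g: "\<And>y. 0 \<le> y \<Longrightarrow> y \<le> 3 / 4 \<Longrightarrow> (g has_real_derivative g' y) (at y)"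
      and B: "\<And>y. 0 \<le> y \<Longrightarrow> y \<le> 3 / 4 \<Longrightarrow> \<bar>g' y\<bar> \<le> B"
      and uv: "0 \<le> u" "u \<le> 3 / 4" "0 \<le> v" "v \<le> 3 / 4" for g g' u v B
  proof -
    have "norm (g u - g v) \<le> B * norm (u - v)"
    proof (rule field_differentiable_bound[of "{0..3/4}"])
      show "(g has_field_derivative g' z) (at z within {0..3/4})" if "z \<in> {0..3/4}" for z
        using g that by (auto intro: has_field_derivative_at_within)
    qed (use B uv in auto)
    also have "\<dots> \<le> B * 1" using B[OF uv(1,2)] uv by (intro mult_left_mono) auto
    finally show ?thesis by simp
  qed
  obtain \<xi> where \<xi>: "0 < \<xi>" "\<xi> < 1 / 2" and "F (1 / 2) - 2 * F (1 / 4) + F 0 = (1 / 4)\<^sup>2 * F2 \<xi>"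
    using second_difference_MVT[of "1 / 4" 0 F F1 F2] F F1 by auto
  then have "\<bar>F2 \<xi>\<bar> \<le> 64 * M"
    using M[of "1 / 2"] M[of "1 / 4"] M[of 0] by (simp add: power2_eq_square)
  then have b2: "\<bar>F2 z\<bar> \<le> 64 * M + Q" if "0 \<le> z" "z \<le> 3 / 4" for z
    using lip[OF F2 Q, of z \<xi>] \<xi> that by auto
  obtain \<zeta> where \<zeta>: "0 < \<zeta>" "\<zeta> < 1 / 2" and "F (1 / 2) - F 0 = (1 / 2 - 0) * F1 \<zeta>"
    using MVT2[of 0 "1 / 2" F F1] F by auto
  then have "\<bar>F1 \<zeta>\<bar> \<le> 4 * M" using M[of "1 / 2"] M[of 0] by auto
  then show "\<bar>F1 y\<bar> \<le> 68 * M + Q"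
    using lip[OF F1 b2, of y \<zeta>] \<zeta> y by auto
  show "\<bar>F2 y\<bar> \<le> 64 * M + Q" by (rule b2[OF y])
qed

text \<open>
  Near \<open>x\<close> the smoothed function has a Taylor expansion of first order. For \<open>t\<close> beyond the range of
  the smoothing, the distance from \<open>x\<close> is at least \<open>1 / 4\<close>, and the trivial bound \<open>O(M)\<close> is
  already \<open>O(M * (t - x)\<^sup>2)\<close>.
\<close>

lemma linear_approximation_left_half:
  fixes \<phi> :: "real \<Rightarrow> real"
  assumes cont: "continuous_on {0..1} \<phi>" and h: "0 < h" "h \<le> 1"
    and W: "\<And>y s. 0 \<le> s \<Longrightarrow> s \<le> h \<Longrightarrow> 0 \<le> y \<Longrightarrow> y + 3 * s \<le> 1 \<Longrightarrow> \<bar>third_difference \<phi> s y\<bar> \<le> W"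
    and m: "\<And>t. 0 \<le> t \<Longrightarrow> t \<le> 1 \<Longrightarrow> \<bar>\<phi> t\<bar> \<le> m"
    and x: "0 \<le> x" "x \<le> 1 / 2"
  shows "\<exists>b. \<bar>b\<bar> \<le> 3200000 * (m + W / h ^ 3) \<and>
    (\<forall>t\<in>{0..1}. \<bar>\<phi> t - \<phi> x - b * (t - x)\<bar> \<le> 3200000 * (W + (m + W / h ^ 3) * (t - x)\<^sup>2))"
proof -
  define M where "M = m + W / h ^ 3"
  have W0: "0 \<le> W" using W[of 0 0] h by (simp add: third_difference_def)
  have m0: "0 \<le> m" using m[of 0] by simp
  have "W / 1 \<le> W / h ^ 3" using W0 h by (intro divide_left_mono) (auto intro: power_le_one)
  then have mW: "m + W \<le> M" by (simp add: M_def)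
  have M0: "0 \<le> M" using mW m0 W0 by simp
  obtain F F1 F2 F3 where
    F: "\<And>y. 0 \<le> y \<Longrightarrow> y \<le> 3 / 4 \<Longrightarrow> (F has_real_derivative F1 y) (at y)" and
    F1: "\<And>y. 0 \<le> y \<Longrightarrow> y \<le> 3 / 4 \<Longrightarrow> (F1 has_real_derivative F2 y) (at y)" and
    F2: "\<And>y. 0 \<le> y \<Longrightarrow> y \<le> 3 / 4 \<Longrightarrow> (F2 has_real_derivative F3 y) (at y)" and
    near: "\<And>y. 0 \<le> y \<Longrightarrow> y \<le> 3 / 4 \<Longrightarrow> \<bar>F y - \<phi> y\<bar> \<le> W" and
    F3': "\<And>y. 0 \<le> y \<Longrightarrow> y \<le> 3 / 4 \<Longrightarrow> \<bar>F3 y\<bar> \<le> 4 * W / (h / 36) ^ 3"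
    by (rule third_order_smoothing[OF cont, of "h / 36" W]) (use h W in auto)
  \<comment> \<open>The smoothing with parameter \<open>h / 36\<close> looks ahead by nine times that parameter, hence by at
    most \<open>1 / 4\<close>, and its differences have steps at most \<open>h / 12\<close>. The numerical constants below
    all stem from \<open>186624 = 4 * 36 ^ 3\<close>, and \<open>3200000\<close> is \<open>16 * 200000\<close>, where \<open>16\<close> comes from
    \<open>\<bar>t - x\<bar> \<ge> 1 / 4\<close>.\<close>
  have "4 * W / (h / 36) ^ 3 = 186624 * (W / h ^ 3)" by (simp add: power_divide)
  also have "\<dots> \<le> 186624 * M" using m0 by (simp add: M_def)
  finally have F3: "\<bar>F3 y\<bar> \<le> 186624 * M" if "0 \<le> y" "y \<le> 3 / 4" for y
    using F3'[OF that] by simp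
  have FM: "\<bar>F y\<bar> \<le> M" if "0 \<le> y" "y \<le> 3 / 4" for y
    using near[OF that] m[of y] that mW by auto
  note bounds = intermediate_derivative_bounds[OF F F1 F2 FM F3]
  have b: "\<bar>F1 x\<bar> \<le> 186692 * M" using bounds(2)[of x] x by simp
  have "\<bar>\<phi> t - \<phi> x - F1 x * (t - x)\<bar> \<le> 3200000 * (W + M * (t - x)\<^sup>2)" if t: "t \<in> {0..1}" for t
  proof (cases "t \<le> 3 / 4")
    case True
    have taylor: "\<bar>F t - F x - F1 x * (t - x)\<bar> \<le> 186688 * M * (t - x)\<^sup>2"
    proof -
      have "norm (F t - F x - F1 x * (t - x)) \<le> 186688 * M * norm (t - x) * norm (t - x)"
      proof -
        have "norm ((F t - F1 x * t) - (F x - F1 x * x)) \<le> (186688 * M * norm (t - x)) * norm (t - x)"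
        proof (rule field_differentiable_bound[of "closed_segment x t"])
          fix z assume z: "z \<in> closed_segment x t"
          have sub: "closed_segment x t \<subseteq> {0..3/4}"
            using x t True by (auto simp: closed_segment_eq_real_ivl)
          then have z01: "0 \<le> z" "z \<le> 3 / 4" using z by auto
          show "((\<lambda>t. F t - F1 x * t) has_field_derivative F1 z - F1 x) (at z within closed_segment x t)"
            using has_field_derivative_at_within[OF F[OF z01]] by (auto intro!: derivative_eq_intros)
          have "norm (F1 z - F1 x) \<le> 186688 * M * norm (z - x)"
          proof (rule field_differentiable_bound[of "{0..3/4}"])
            show "(F1 has_field_derivative F2 w) (at w within {0..3/4})" if "w \<in> {0..3/4}" for w
              using F1 that by (auto intro: has_field_derivative_at_within)
            show "norm (F2 w) \<le> 186688 * M" if "w \<in> {0..3/4}" for w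
              using bounds(1)[of w] that by auto
          qed (use z01 x in auto)
          also have "\<dots> \<le> 186688 * M * norm (t - x)"
            using z M0 by (intro mult_left_mono) (auto simp: closed_segment_eq_real_ivl split: if_splits)
          finally show "norm (F1 z - F1 x) \<le> 186688 * M * norm (t - x)" .
        qed auto
        then show ?thesis by (simp add: algebra_simps)
      qed
      then show ?thesis by (simp add: power2_eq_square mult.assoc)
    qed
    have "\<bar>\<phi> t - \<phi> x - F1 x * (t - x)\<bar> \<le> 2 * W + 186688 * M * (t - x)\<^sup>2"
      using taylor near[of t] near[of x] t True x by (auto simp: abs_le_iff)
    also have "\<dots> \<le> 3200000 * (W + M * (t - x)\<^sup>2)"
      using W0 mult_nonneg_nonneg[OF M0, of "(t - x)\<^sup>2"] by simp
    finally show ?thesis .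
  next
    case False
    have "\<bar>F1 x * (t - x)\<bar> \<le> 186692 * M * 1"
      unfolding abs_mult using b t x M0 by (intro mult_mono) auto
    then have "\<bar>\<phi> t - \<phi> x - F1 x * (t - x)\<bar> \<le> 200000 * M"
      using m[of t] m[of x] t x mW W0 by auto
    also have "\<dots> = 3200000 * (M * (1 / 4)\<^sup>2)" by (simp add: power2_eq_square)
    also have "\<dots> \<le> 3200000 * (M * (t - x)\<^sup>2)"
      using False x M0 by (intro mult_left_mono power_mono) auto
    finally show ?thesis using W0 by simp
  qed
  then show ?thesis using b M0 unfolding M_def[symmetric]
    by (intro exI[of _ "F1 x"]) auto
qed

text \<open>
  The right half of the interval follows by the reflection \<open>t \<mapsto> 1 - t\<close>, which preserves third
  differences up to sign.
\<close>

lemma linear_approximation: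
  fixes \<phi> :: "real \<Rightarrow> real"
  assumes cont: "continuous_on {0..1} \<phi>" and h: "0 < h" "h \<le> 1"
    and W: "\<And>y s. 0 \<le> s \<Longrightarrow> s \<le> h \<Longrightarrow> 0 \<le> y \<Longrightarrow> y + 3 * s \<le> 1 \<Longrightarrow> \<bar>third_difference \<phi> s y\<bar> \<le> W"
    and m: "\<And>t. 0 \<le> t \<Longrightarrow> t \<le> 1 \<Longrightarrow> \<bar>\<phi> t\<bar> \<le> m"
    and x: "0 \<le> x" "x \<le> 1"
  shows "\<exists>b. \<bar>b\<bar> \<le> 3200000 * (m + W / h ^ 3) \<and>
    (\<forall>t\<in>{0..1}. \<bar>\<phi> t - \<phi> x - b * (t - x)\<bar> \<le> 3200000 * (W + (m + W / h ^ 3) * (t - x)\<^sup>2))"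
proof (cases "x \<le> 1 / 2")
  case True
  with linear_approximation_left_half[OF cont h W m] x show ?thesis by blast
next
  case False
  have "\<exists>b. \<bar>b\<bar> \<le> 3200000 * (m + W / h ^ 3) \<and>
    (\<forall>t\<in>{0..1}. \<bar>\<phi> (1 - t) - \<phi> (1 - (1 - x)) - b * (t - (1 - x))\<bar>
      \<le> 3200000 * (W + (m + W / h ^ 3) * (t - (1 - x))\<^sup>2))"
  proof (rule linear_approximation_left_half[OF _ h])
    show "continuous_on {0..1} (\<lambda>t. \<phi> (1 - t))"
      by (intro continuous_on_compose2[OF cont] continuous_intros) auto
    fix y s :: real assume ys: "0 \<le> s" "s \<le> h" "0 \<le> y" "y + 3 * s \<le> 1"
    have "1 - (y + 3 * s) + 3 * s = 1 - y" "1 - (y + 3 * s) + 2 * s = 1 - (y + s)"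
      "1 - (y + 3 * s) + s = 1 - (y + 2 * s)" by simp_all
    note reflect = this
    have "third_difference (\<lambda>t. \<phi> (1 - t)) s y = - third_difference \<phi> s (1 - (y + 3 * s))"
      unfolding third_difference_def reflect by linarith
    then show "\<bar>third_difference (\<lambda>t. \<phi> (1 - t)) s y\<bar> \<le> W"
      using W[of s "1 - (y + 3 * s)"] ys by auto
  qed (use False x m in auto)
  then obtain b where b: "\<bar>b\<bar> \<le> 3200000 * (m + W / h ^ 3)"
    and *: "\<And>t. t \<in> {0..1} \<Longrightarrow> \<bar>\<phi> (1 - t) - \<phi> (1 - (1 - x)) - b * (t - (1 - x))\<bar>
      \<le> 3200000 * (W + (m + W / h ^ 3) * (t - (1 - x))\<^sup>2)" by blast
  have "\<bar>\<phi> t - \<phi> x - (- b) * (t - x)\<bar> \<le> 3200000 * (W + (m + W / h ^ 3) * (t - x)\<^sup>2)"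
    if "t \<in> {0..1}" for t
    using *[of "1 - t"] that by (simp add: algebra_simps power2_commute[of x t])
  then show ?thesis using b by (intro exI[of _ "- b"]) auto
qed

section \<open>Central moments of the Bernstein distribution\<close>

text \<open>
  Conditioning a binomial variable on its last trial: Pascal's rule, read as a recursion for expectations.
  It gives the central moments by induction on \<open>n\<close>.
\<close>

lemma sum_Bernstein_Suc:
  "(\<Sum>k\<le>Suc n. f k * Bernstein (Suc n) k x)
     = (\<Sum>k\<le>n. (x * f (Suc k) + (1 - x) * f k) * Bernstein n k x)"
proof -
  have pascal: "Bernstein (Suc n) (Suc k) x = x * Bernstein n k x + (1 - x) * Bernstein n (Suc k) x" for k
  proof (cases "k < n")
    case True
    then have "n - k = Suc (n - Suc k)" by simp
    then show ?thesis by (simp add: Bernstein_def algebra_simps)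
  qed (simp add: Bernstein_def algebra_simps)
  have "(\<Sum>k\<le>Suc n. f k * Bernstein (Suc n) k x)
      = f 0 * Bernstein (Suc n) 0 x + (\<Sum>k\<le>n. f (Suc k) * Bernstein (Suc n) (Suc k) x)"
    by (rule sum.atMost_Suc_shift)
  also have "\<dots> = (\<Sum>k\<le>n. x * f (Suc k) * Bernstein n k x)
      + (1 - x) * (f 0 * Bernstein n 0 x + (\<Sum>k\<le>n. f (Suc k) * Bernstein n (Suc k) x))"
  proof -
    have zero: "Bernstein (Suc n) 0 x = (1 - x) * Bernstein n 0 x" by (simp add: Bernstein_def)
    have "(\<Sum>k\<le>n. f (Suc k) * Bernstein (Suc n) (Suc k) x)
        = (\<Sum>k\<le>n. x * f (Suc k) * Bernstein n k x)
          + (1 - x) * (\<Sum>k\<le>n. f (Suc k) * Bernstein n (Suc k) x)"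
      unfolding pascal sum_distrib_left sum.distrib[symmetric]
      by (intro sum.cong refl) (simp add: algebra_simps)
    then show ?thesis unfolding zero by (simp add: algebra_simps)
  qed
  also have "f 0 * Bernstein n 0 x + (\<Sum>k\<le>n. f (Suc k) * Bernstein n (Suc k) x)
      = (\<Sum>k\<le>Suc n. f k * Bernstein n k x)"
    by (rule sum.atMost_Suc_shift[symmetric])
  also have "\<dots> = (\<Sum>k\<le>n. f k * Bernstein n k x)"
    by (simp add: Bernstein_def)
  finally show ?thesis
    unfolding sum_distrib_left sum.distrib[symmetric] by (simp add: distrib_right mult.assoc)
qed

lemma Bernstein_central_moments:
  fixes x :: real
  defines "X \<equiv> x * (1 - x)"
  shows "(\<Sum>k\<le>n. (real k - n * x) * Bernstein n k x) = 0"
    and "(\<Sum>k\<le>n. (real k - n * x)\<^sup>2 * Bernstein n k x) = n * X"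
    and "(\<Sum>k\<le>n. (real k - n * x) ^ 3 * Bernstein n k x) = n * X * (1 - 2 * x)"
    and "(\<Sum>k\<le>n. (real k - n * x) ^ 4 * Bernstein n k x) = 3 * n\<^sup>2 * X\<^sup>2 + n * X * (1 - 6 * X)"
proof (induction n)
  case 0
  { case 1 show ?case by simp }
  { case 2 show ?case by simp }
  { case 3 show ?case by simp }
  { case 4 show ?case by simp }
next
  case (Suc n)
  let ?T = "\<lambda>j. \<Sum>k\<le>n. (real k - n * x) ^ j * Bernstein n k x"
  have T: "?T 0 = 1" "?T 1 = 0" "?T 2 = n * X" "?T 3 = n * X * (1 - 2 * x)"
      "?T 4 = 3 * n\<^sup>2 * X\<^sup>2 + n * X * (1 - 6 * X)"
    using Suc by simp_all
  have step: "(\<Sum>k\<le>Suc n. (real k - Suc n * x) ^ j * Bernstein (Suc n) k x)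
      = (\<Sum>k\<le>n. (x * (real k - n * x + (1 - x)) ^ j + (1 - x) * (real k - n * x - x) ^ j)
            * Bernstein n k x)" for j
    unfolding sum_Bernstein_Suc by (simp add: algebra_simps)
  { case 1
    have "(\<Sum>k\<le>Suc n. (real k - Suc n * x) ^ 1 * Bernstein (Suc n) k x) = ?T 1"
      unfolding step by (intro sum.cong refl) (simp add: algebra_simps)
    then show ?case using T by simp }
  { case 2
    have "(\<Sum>k\<le>Suc n. (real k - Suc n * x) ^ 2 * Bernstein (Suc n) k x) = ?T 2 + X * ?T 0"
      unfolding step sum_distrib_left sum.distrib[symmetric] X_def
      by (intro sum.cong refl) (simp add: algebra_simps power2_eq_square)
    then show ?case using T by (simp add: algebra_simps) }
  { case 3
    have "(\<Sum>k\<le>Suc n. (real k - Suc n * x) ^ 3 * Bernstein (Suc n) k x)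
        = ?T 3 + 3 * X * ?T 1 + X * (1 - 2 * x) * ?T 0"
      unfolding step sum_distrib_left sum.distrib[symmetric] X_def
      by (intro sum.cong refl) (simp add: algebra_simps power3_eq_cube)
    then show ?case using T by (simp add: algebra_simps) }
  { case 4
    have "(\<Sum>k\<le>Suc n. (real k - Suc n * x) ^ 4 * Bernstein (Suc n) k x)
        = ?T 4 + 6 * X * ?T 2 + 4 * X * (1 - 2 * x) * ?T 1 + X * (1 - 3 * X) * ?T 0"
      unfolding step sum_distrib_left sum.distrib[symmetric] X_def
      by (intro sum.cong refl) (simp add: algebra_simps power4_eq_xxxx power2_eq_square power3_eq_cube)
    then show ?case unfolding T by (simp add: algebra_simps power2_eq_square) }
qed

section \<open>The Kantorovich operator as an expectation\<close>

lemma kantorovich_cell_subset: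
  assumes "k \<le> n"
  shows "{real k / (real n + 1) .. (real k + 1) / (real n + 1)} \<subseteq> {0..1}"
  using assms by auto

lemma integrable_on_kantorovich_cell:
  fixes u :: "real \<Rightarrow> real"
  assumes "continuous_on {0..1} u" "k \<le> n"
  shows "u integrable_on {real k / (real n + 1) .. (real k + 1) / (real n + 1)}"
  by (intro integrable_continuous_real continuous_on_subset[OF assms(1)] kantorovich_cell_subset assms(2))

lemma kantorovich_cong:
  assumes "\<And>t. t \<in> {0..1} \<Longrightarrow> u t = v t"
  shows "kantorovich n u x = kantorovich n v x"
proof -
  have "integral {real k / (real n + 1) .. (real k + 1) / (real n + 1)} u
      = integral {real k / (real n + 1) .. (real k + 1) / (real n + 1)} v" if "k \<le> n" for k
    by (intro Henstock_Kurzweil_Integration.integral_cong assms subsetD[OF kantorovich_cell_subset[OF that]])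
  then show ?thesis by (simp add: kantorovich_def)
qed

lemma kantorovich_add:
  assumes "continuous_on {0..1} u" "continuous_on {0..1} v"
  shows "kantorovich n (\<lambda>t. u t + v t) x = kantorovich n u x + kantorovich n v x"
proof -
  have "(\<Sum>k\<le>n. Bernstein n k x * integral {real k / (real n + 1) .. (real k + 1) / (real n + 1)} (\<lambda>t. u t + v t))
    = (\<Sum>k\<le>n. Bernstein n k x * integral {real k / (real n + 1) .. (real k + 1) / (real n + 1)} u
        + Bernstein n k x * integral {real k / (real n + 1) .. (real k + 1) / (real n + 1)} v)"
    using assms
    by (intro sum.cong refl)
       (simp add: Henstock_Kurzweil_Integration.integral_add integrable_on_kantorovich_cell distrib_left)
  then show ?thesis by (simp add: kantorovich_def sum.distrib distrib_left)
qed

lemma kantorovich_cmult: "kantorovich n (\<lambda>t. c * u t) x = c * kantorovich n u x"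
  by (simp add: kantorovich_def sum_distrib_left mult_ac)

lemma kantorovich_const: "kantorovich n (\<lambda>t. c) x = c"
proof -
  have "(real k + 1) / (real n + 1) - real k / (real n + 1) = 1 / (real n + 1)" for k
    by (simp add: diff_divide_distrib[symmetric])
  then have "integral {real k / (real n + 1) .. (real k + 1) / (real n + 1)} (\<lambda>t. c) = c / (real n + 1)" for k
    using divide_right_mono[of "real k" "real k + 1" "real n + 1"] by simp
  then have "kantorovich n (\<lambda>t. c) x = (real n + 1) * (\<Sum>k\<le>n. Bernstein n k x * (c / (real n + 1)))"
    by (simp only: kantorovich_def)
  also have "\<dots> = c" by (subst sum_distrib_right[symmetric]) simp
  finally show ?thesis .
qed

lemma kantorovich_mono:
  assumes "continuous_on {0..1} u" "continuous_on {0..1} v" "x \<in> {0..1}"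
    and "\<And>t. t \<in> {0..1} \<Longrightarrow> u t \<le> v t"
  shows "kantorovich n u x \<le> kantorovich n v x"
proof -
  have "integral {real k / (real n + 1) .. (real k + 1) / (real n + 1)} u
      \<le> integral {real k / (real n + 1) .. (real k + 1) / (real n + 1)} v" if "k \<le> n" for k
    by (intro integral_le integrable_on_kantorovich_cell[OF _ that] assms
          subsetD[OF kantorovich_cell_subset[OF that]])
  then show ?thesis unfolding kantorovich_def
    using assms(3) by (intro mult_left_mono sum_mono Bernstein_nonneg) auto
qed

lemma kantorovich_abs_le:
  assumes "continuous_on {0..1} u" "continuous_on {0..1} v" "x \<in> {0..1}"
    and "\<And>t. t \<in> {0..1} \<Longrightarrow> \<bar>u t\<bar> \<le> v t"
  shows "\<bar>kantorovich n u x\<bar> \<le> kantorovich n v x"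
proof -
  have "kantorovich n u x \<le> kantorovich n v x"
    using assms by (intro kantorovich_mono) (auto simp: abs_le_iff)
  moreover have "kantorovich n (\<lambda>t. - 1 * u t) x \<le> kantorovich n v x"
    using assms by (intro kantorovich_mono continuous_intros) (auto simp: abs_le_iff)
  ultimately show ?thesis unfolding kantorovich_cmult by simp
qed

text \<open>
  The variance of \<open>u\<close> is nonnegative.
\<close>

lemma kantorovich_power2_le:
  assumes "continuous_on {0..1} u" "x \<in> {0..1}"
  shows "(kantorovich n u x)\<^sup>2 \<le> kantorovich n (\<lambda>t. (u t)\<^sup>2) x"
proof -
  define c where "c = kantorovich n u x"
  have "kantorovich n (\<lambda>t. 0) x \<le> kantorovich n (\<lambda>t. (u t)\<^sup>2 + (- 2 * c * u t + c\<^sup>2)) x"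
  proof (intro kantorovich_mono continuous_intros assms)
    fix t :: real
    have "(u t)\<^sup>2 + (- 2 * c * u t + c\<^sup>2) = (u t - c)\<^sup>2" by (simp add: power2_eq_square algebra_simps)
    then show "0 \<le> (u t)\<^sup>2 + (- 2 * c * u t + c\<^sup>2)" by simp
  qed
  also have "\<dots> = kantorovich n (\<lambda>t. (u t)\<^sup>2) x + (- 2 * c * c + c\<^sup>2)"
  proof -
    have c1: "continuous_on {0..1} (\<lambda>t. (u t)\<^sup>2)" "continuous_on {0..1} (\<lambda>t. - 2 * c * u t)"
      "continuous_on {0..1} (\<lambda>t. - 2 * c * u t + c\<^sup>2)"
      by (intro continuous_intros assms(1))+
    show ?thesis
      unfolding kantorovich_add[OF c1(1,3)] kantorovich_add[OF c1(2) continuous_on_const]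
        kantorovich_cmult kantorovich_const c_def[symmetric] ..
  qed
  finally show ?thesis by (simp add: kantorovich_const c_def power2_eq_square)
qed

section \<open>Central moments of the Kantorovich operator\<close>

text \<open>
  The cell with index \<open>k\<close> has midpoint \<open>x + (s k + a) / (n + 1)\<close> and half-width
  \<open>(1 / 2) / (n + 1)\<close>, which explains the shifts by \<open>1 / 2\<close>. The summand is a polynomial in
  \<open>s k\<close>, so the Bernstein central moments evaluate the sum.
\<close>

lemma kantorovich_central_power:
  fixes n :: nat and x :: real
  defines "s \<equiv> \<lambda>k. real k - n * x" and "a \<equiv> 1 / 2 - x"
  shows "kantorovich n (\<lambda>t. (t - x) ^ j) x
    = (\<Sum>k\<le>n. ((s k + a + 1 / 2) ^ Suc j - (s k + a - 1 / 2) ^ Suc j) / Suc j * Bernstein n k x)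
        / (real n + 1) ^ j"
proof -
  define N where "N = real n + 1"
  have N: "0 < N" by (simp add: N_def)
  have cell: "N * integral {real k / N .. (real k + 1) / N} (\<lambda>t. (t - x) ^ j)
      = ((s k + a + 1 / 2) ^ Suc j - (s k + a - 1 / 2) ^ Suc j) / Suc j / N ^ j" for k
  proof -
    have "((\<lambda>t. (t - x) ^ j) has_integral
        (((real k + 1) / N - x) ^ Suc j / Suc j - (real k / N - x) ^ Suc j / Suc j))
        {real k / N .. (real k + 1) / N}"
    proof (rule fundamental_theorem_of_calculus)
      show "real k / N \<le> (real k + 1) / N" using N by (simp add: divide_right_mono)
      show "((\<lambda>t. (t - x) ^ Suc j / Suc j) has_vector_derivative (t - x) ^ j)
          (at t within {real k / N .. (real k + 1) / N})" for t
        unfolding has_real_derivative_iff_has_vector_derivative[symmetric]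
        by (auto intro!: derivative_eq_intros simp del: power_Suc) 
    qed
    moreover have "(real k + 1) / N - x = (s k + a + 1 / 2) / N" "real k / N - x = (s k + a - 1 / 2) / N"
      using N by (simp_all add: s_def a_def field_simps) (simp_all add: N_def algebra_simps)
    ultimately have "integral {real k / N .. (real k + 1) / N} (\<lambda>t. (t - x) ^ j)
        = ((s k + a + 1 / 2) / N) ^ Suc j / Suc j - ((s k + a - 1 / 2) / N) ^ Suc j / Suc j"
      by (metis integral_unique)
    then show ?thesis using N
      by (simp add: power_divide diff_divide_distrib[symmetric] del: of_nat_Suc)
  qed
  have "kantorovich n (\<lambda>t. (t - x) ^ j) x
      = (\<Sum>k\<le>n. Bernstein n k x * (N * integral {real k / N .. (real k + 1) / N} (\<lambda>t. (t - x) ^ j)))"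
    by (simp add: kantorovich_def N_def sum_distrib_left mult_ac)
  then show ?thesis unfolding cell N_def[symmetric] sum_divide_distrib
    by (simp add: mult_ac)
qed

text \<open>
  Here \<open>a / N\<close> is the bias of the operator, and \<open>1 - 2 * x = 2 * a\<close> absorbs the third Bernstein moment
  into multiples of \<open>a\<close>.
\<close>

lemma kantorovich_central_moments:
  fixes n :: nat and x X a N :: real
  defines "X \<equiv> x * (1 - x)" and "a \<equiv> 1 / 2 - x" and "N \<equiv> real n + 1"
  shows "kantorovich n (\<lambda>t. t - x) x = a / N"
    and "kantorovich n (\<lambda>t. (t - x)\<^sup>2) x = (n * X + a\<^sup>2 + 1 / 12) / N\<^sup>2"
    and "kantorovich n (\<lambda>t. (t - x) ^ 3) x = (5 * a * n * X + a ^ 3 + a / 4) / N ^ 3"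
    and "kantorovich n (\<lambda>t. (t - x) ^ 4) x
      = (3 * (n * X)\<^sup>2 + n * X * (1 - 6 * X) + 14 * a\<^sup>2 * n * X + n * X / 2 + a ^ 4 + a\<^sup>2 / 2 + 1 / 80) / N ^ 4"
proof -
  let ?T = "\<lambda>j. \<Sum>k\<le>n. (real k - n * x) ^ j * Bernstein n k x"
  have T: "?T 0 = 1" "?T 1 = 0" "?T 2 = n * X" "?T 3 = n * X * (2 * a)"
      "?T 4 = 3 * n\<^sup>2 * X\<^sup>2 + n * X * (1 - 6 * X)"
  proof -
    have "2 * a = 1 - 2 * x" by (simp add: a_def)
    then show "?T 3 = n * X * (2 * a)"
      using Bernstein_central_moments(3)[where n = n and x = x, folded X_def] by simp
    show "?T 0 = 1" by simp
  qed (simp_all only: power_one_right X_def Bernstein_central_moments of_nat_mult of_nat_numeral of_nat_power)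
  have cell: "((y + 1 / 2) ^ 2 - (y - 1 / 2) ^ 2) / 2 = y"
    "((y + 1 / 2) ^ 3 - (y - 1 / 2) ^ 3) / 3 = y\<^sup>2 + 1 / 12"
    "((y + 1 / 2) ^ 4 - (y - 1 / 2) ^ 4) / 4 = y ^ 3 + y / 4"
    "((y + 1 / 2) ^ 5 - (y - 1 / 2) ^ 5) / 5 = y ^ 4 + y\<^sup>2 / 2 + 1 / 80" for y :: real
  proof -
    have expand: "(y + h) ^ 2 - (y - h) ^ 2 = 4 * h * y"
      "(y + h) ^ 3 - (y - h) ^ 3 = 2 * h * (3 * y ^ 2 + h ^ 2)"
      "(y + h) ^ 4 - (y - h) ^ 4 = 8 * h * (y ^ 3 + y * h ^ 2)"
      "(y + h) ^ 5 - (y - h) ^ 5 = 2 * h * (5 * y ^ 4 + 10 * y ^ 2 * h ^ 2 + h ^ 4)" for h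
      by algebra+
    show "((y + 1 / 2) ^ 2 - (y - 1 / 2) ^ 2) / 2 = y"
      "((y + 1 / 2) ^ 3 - (y - 1 / 2) ^ 3) / 3 = y\<^sup>2 + 1 / 12"
      "((y + 1 / 2) ^ 4 - (y - 1 / 2) ^ 4) / 4 = y ^ 3 + y / 4"
      "((y + 1 / 2) ^ 5 - (y - 1 / 2) ^ 5) / 5 = y ^ 4 + y\<^sup>2 / 2 + 1 / 80"
      unfolding expand by (simp_all add: power_divide)
  qed
  note K = kantorovich_central_power[where n = n and x = x, folded a_def N_def]
  let ?B = "\<lambda>k. Bernstein n k x" and ?s = "\<lambda>k. real k - n * x"
  have K1: "kantorovich n (\<lambda>t. (t - x) ^ 1) x = (\<Sum>k\<le>n. (?s k + a) * ?B k) / N ^ 1"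
    using K[of 1] unfolding Suc_1 of_nat_numeral cell by simp
  have K2: "kantorovich n (\<lambda>t. (t - x) ^ 2) x = (\<Sum>k\<le>n. ((?s k + a)\<^sup>2 + 1 / 12) * ?B k) / N ^ 2"
    using K[of 2] unfolding Suc_numeral of_nat_numeral add_num_simps cell by simp
  have K3: "kantorovich n (\<lambda>t. (t - x) ^ 3) x
      = (\<Sum>k\<le>n. ((?s k + a) ^ 3 + (?s k + a) / 4) * ?B k) / N ^ 3"
    using K[of 3] unfolding Suc_numeral of_nat_numeral add_num_simps cell by simp
  have K4: "kantorovich n (\<lambda>t. (t - x) ^ 4) x
      = (\<Sum>k\<le>n. ((?s k + a) ^ 4 + (?s k + a)\<^sup>2 / 2 + 1 / 80) * ?B k) / N ^ 4"
    using K[of 4] unfolding Suc_numeral of_nat_numeral add_num_simps cell by simp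
  show "kantorovich n (\<lambda>t. t - x) x = a / N"
    using K1 T(1,2) by (simp add: distrib_right sum.distrib flip: sum_distrib_left)
  have "(\<Sum>k\<le>n. ((?s k + a)\<^sup>2 + 1 / 12) * ?B k) = ?T 2 + 2 * a * ?T 1 + (a\<^sup>2 + 1 / 12) * ?T 0"
    unfolding sum_distrib_left sum.distrib[symmetric]
    by (intro sum.cong refl) (simp add: power2_eq_square algebra_simps)
  then show "kantorovich n (\<lambda>t. (t - x)\<^sup>2) x = (n * X + a\<^sup>2 + 1 / 12) / N\<^sup>2"
    unfolding K2 T by simp
  have "(s + a) ^ 3 + (s + a) / 4
      = s ^ 3 + 3 * a * s ^ 2 + (3 * a\<^sup>2 + 1 / 4) * s ^ 1 + (a ^ 3 + a / 4) * s ^ 0" for s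
    by (simp add: power2_eq_square power3_eq_cube algebra_simps)
  then have "(\<Sum>k\<le>n. ((?s k + a) ^ 3 + (?s k + a) / 4) * ?B k)
      = ?T 3 + 3 * a * ?T 2 + (3 * a\<^sup>2 + 1 / 4) * ?T 1 + (a ^ 3 + a / 4) * ?T 0"
    unfolding sum_distrib_left sum.distrib[symmetric]
    by (intro sum.cong refl) (simp only: distrib_right mult.assoc)
  then show "kantorovich n (\<lambda>t. (t - x) ^ 3) x = (5 * a * n * X + a ^ 3 + a / 4) / N ^ 3"
    unfolding K3 T by (simp add: algebra_simps)
  have "(s + a) ^ 4 + (s + a)\<^sup>2 / 2 + 1 / 80
      = s ^ 4 + 4 * a * s ^ 3 + (6 * a\<^sup>2 + 1 / 2) * s ^ 2 + (4 * a ^ 3 + a) * s ^ 1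
          + (a ^ 4 + a\<^sup>2 / 2 + 1 / 80) * s ^ 0" for s
    by (simp add: power2_eq_square power3_eq_cube power4_eq_xxxx algebra_simps)
  then have "(\<Sum>k\<le>n. ((?s k + a) ^ 4 + (?s k + a)\<^sup>2 / 2 + 1 / 80) * ?B k)
      = ?T 4 + 4 * a * ?T 3 + (6 * a\<^sup>2 + 1 / 2) * ?T 2 + (4 * a ^ 3 + a) * ?T 1
          + (a ^ 4 + a\<^sup>2 / 2 + 1 / 80) * ?T 0"
    unfolding sum_distrib_left sum.distrib[symmetric]
    by (intro sum.cong refl) (simp only: distrib_right mult.assoc)
  then show "kantorovich n (\<lambda>t. (t - x) ^ 4) x
      = (3 * (n * X)\<^sup>2 + n * X * (1 - 6 * X) + 14 * a\<^sup>2 * n * X + n * X / 2 + a ^ 4 + a\<^sup>2 / 2 + 1 / 80) / N ^ 4"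
    unfolding K4 T by (simp add: algebra_simps power2_eq_square)
qed

lemma kantorovich_central_moment_bounds:
  fixes n :: nat and x :: real
  assumes n: "n \<ge> 1" and x: "x \<in> {0..1}"
  shows "\<bar>kantorovich n (\<lambda>t. t - x) x\<bar> \<le> 1 / (2 * n)"
    and "kantorovich n (\<lambda>t. (t - x)\<^sup>2) x \<le> 1 / n"
    and "kantorovich n (\<lambda>t. (t - x) ^ 4) x \<le> 3 / n\<^sup>2"
proof -
  define X a N m where "X = x * (1 - x)" and "a = 1 / 2 - x" and "N = real n + 1" and "m = real n"
  have m: "1 \<le> m" "m \<le> N" "N = m + 1" using n by (simp_all add: m_def N_def)
  have a: "\<bar>a\<bar> \<le> 1 / 2" using x unfolding a_def abs_le_iff by auto
  have a2: "0 \<le> a\<^sup>2" "a\<^sup>2 \<le> 1 / 4"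
    using abs_le_square_iff[of a "1 / 2"] a by (auto simp: power2_eq_square)
  have X: "0 \<le> X" "X = 1 / 4 - a\<^sup>2"
    using x by (auto simp: X_def a_def power2_eq_square algebra_simps mult_left_le)
  then have X4: "X \<le> 1 / 4" using a2 by simp
  note K = kantorovich_central_moments[of n x, folded X_def a_def N_def m_def]
  have "\<bar>a\<bar> / N \<le> (1 / 2) / m" using a m by (intro frac_le) auto
  then show "\<bar>kantorovich n (\<lambda>t. t - x) x\<bar> \<le> 1 / (2 * n)"
    unfolding K using m by (simp add: abs_mult m_def)
  have mX: "0 \<le> m * X" "m * X \<le> m / 4" using X X4 m mult_left_mono[of X "1/4" m] by auto
  have "m * X + a\<^sup>2 + 1 / 12 \<le> N" using mX a2 m by linarith
  then have "(m * X + a\<^sup>2 + 1 / 12) / N\<^sup>2 \<le> N / N\<^sup>2" by (intro divide_right_mono) auto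
  also have "\<dots> \<le> 1 / m" using m by (simp add: power2_eq_square frac_le)
  finally show "kantorovich n (\<lambda>t. (t - x)\<^sup>2) x \<le> 1 / n" unfolding K by (simp add: m_def)
  have "3 * (m * X)\<^sup>2 + m * X * (1 - 6 * X) + 14 * a\<^sup>2 * m * X + m * X / 2 + a ^ 4 + a\<^sup>2 / 2 + 1 / 80
      \<le> 3 * m\<^sup>2"
  proof -
    have 1: "(m * X)\<^sup>2 \<le> (m / 4)\<^sup>2" using mX by (intro power_mono) auto
    have 2: "m * X * (1 - 6 * X) \<le> m * X * 1" using mX X by (intro mult_left_mono) auto
    have 3: "14 * a\<^sup>2 * m * X \<le> 14 * (1 / 4) * m * X"
      using a2 mX m X by (intro mult_right_mono mult_left_mono) auto
    have "(a\<^sup>2)\<^sup>2 \<le> (1 / 4)\<^sup>2" using a2 by (intro power_mono) auto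
    then have 4: "a ^ 4 \<le> 1 / 16" by (simp add: power2_eq_square power4_eq_xxxx mult.assoc)
    have 5: "m \<le> m\<^sup>2" "1 \<le> m\<^sup>2" using m by (auto simp: self_le_power one_le_power)
    have 6: "(m / 4)\<^sup>2 = m\<^sup>2 / 16" by (simp add: power2_eq_square)
    show ?thesis using 1 2 3 4 5 a2 mX unfolding 6 by linarith
  qed
  then have "kantorovich n (\<lambda>t. (t - x) ^ 4) x \<le> 3 * m\<^sup>2 / N ^ 4"
    unfolding K by (intro divide_right_mono) auto
  also have "\<dots> \<le> 3 * m\<^sup>2 / m ^ 4" using m by (intro divide_left_mono power_mono) auto
  also have "\<dots> = 3 / n\<^sup>2" using m by (simp add: m_def power2_eq_square power4_eq_xxxx)
  finally show "kantorovich n (\<lambda>t. (t - x) ^ 4) x \<le> 3 / n\<^sup>2" .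
qed

section \<open>Covariances\<close>

definition kantorovich_cov :: "nat \<Rightarrow> real \<Rightarrow> (real \<Rightarrow> real) \<Rightarrow> (real \<Rightarrow> real) \<Rightarrow> real" where
  "kantorovich_cov n x u v
     = kantorovich n (\<lambda>t. u t * v t) x - kantorovich n u x * kantorovich n v x"

lemma kantorovich_cov_commute: "kantorovich_cov n x u v = kantorovich_cov n x v u"
  by (simp add: kantorovich_cov_def mult.commute)

lemma kantorovich_cov_affine:
  assumes f: "\<And>t. t \<in> {0..1} \<Longrightarrow> f t = c + p * u t + S t"
    and u: "continuous_on {0..1} u" and S: "continuous_on {0..1} S" and v: "continuous_on {0..1} v"
  shows "kantorovich_cov n x f v = p * kantorovich_cov n x u v + kantorovich_cov n x S v"
proof -
  have "kantorovich n f x = kantorovich n (\<lambda>t. c + (p * u t + S t)) x"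
    using f by (intro kantorovich_cong) simp
  also have "\<dots> = c + (p * kantorovich n u x + kantorovich n S x)"
  proof -
    have c: "continuous_on {0..1} (\<lambda>t. p * u t)" "continuous_on {0..1} (\<lambda>t. p * u t + S t)"
      by (intro continuous_intros u S)+
    show ?thesis
      unfolding kantorovich_add[OF continuous_on_const c(2)] kantorovich_add[OF c(1) S]
        kantorovich_cmult kantorovich_const ..
  qed
  finally have 1: "kantorovich n f x = c + (p * kantorovich n u x + kantorovich n S x)" .
  have "kantorovich n (\<lambda>t. f t * v t) x = kantorovich n (\<lambda>t. c * v t + (p * (u t * v t) + S t * v t)) x"
    using f by (intro kantorovich_cong) (simp add: algebra_simps)
  also have "\<dots> = c * kantorovich n v x + (p * kantorovich n (\<lambda>t. u t * v t) x + kantorovich n (\<lambda>t. S t * v t) x)"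
  proof -
    have c: "continuous_on {0..1} (\<lambda>t. c * v t)" "continuous_on {0..1} (\<lambda>t. p * (u t * v t))"
      "continuous_on {0..1} (\<lambda>t. S t * v t)" "continuous_on {0..1} (\<lambda>t. p * (u t * v t) + S t * v t)"
      by (intro continuous_intros u S v)+
    show ?thesis
      unfolding kantorovich_add[OF c(1,4)] kantorovich_add[OF c(2,3)] kantorovich_cmult ..
  qed
  finally show ?thesis unfolding kantorovich_cov_def 1 by (simp add: algebra_simps)
qed

text \<open>
  Since \<open>K \<psi> * K \<psi> \<le> K (\<psi>\<^sup>2)\<close>, a common majorant bounds both terms of the covariance.
\<close>

lemma kantorovich_cov_dominated:
  assumes u: "continuous_on {0..1} u" and v: "continuous_on {0..1} v"
    and \<psi>: "continuous_on {0..1} \<psi>" and x: "x \<in> {0..1}" and A: "0 \<le> A" and B: "0 \<le> B"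
    and uA: "\<And>t. t \<in> {0..1} \<Longrightarrow> \<bar>u t\<bar> \<le> A * \<psi> t"
    and vB: "\<And>t. t \<in> {0..1} \<Longrightarrow> \<bar>v t\<bar> \<le> B * \<psi> t"
  shows "\<bar>kantorovich_cov n x u v\<bar> \<le> 2 * (A * B) * kantorovich n (\<lambda>t. (\<psi> t)\<^sup>2) x"
proof -
  let ?K = "\<lambda>f. kantorovich n f x"
  have "\<bar>?K (\<lambda>t. u t * v t)\<bar> \<le> ?K (\<lambda>t. (A * B) * (\<psi> t)\<^sup>2)"
  proof (rule kantorovich_abs_le)
    fix t :: real assume t: "t \<in> {0..1}"
    have "\<bar>u t * v t\<bar> \<le> (A * \<psi> t) * (B * \<psi> t)"
      unfolding abs_mult using uA[OF t] vB[OF t] by (intro mult_mono) auto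
    then show "\<bar>u t * v t\<bar> \<le> (A * B) * (\<psi> t)\<^sup>2" by (simp add: power2_eq_square mult_ac)
  qed (intro continuous_intros u v \<psi> x)+
  then have 1: "\<bar>?K (\<lambda>t. u t * v t)\<bar> \<le> (A * B) * ?K (\<lambda>t. (\<psi> t)\<^sup>2)"
    by (simp only: kantorovich_cmult)
  have "\<bar>?K u\<bar> \<le> ?K (\<lambda>t. A * \<psi> t)" "\<bar>?K v\<bar> \<le> ?K (\<lambda>t. B * \<psi> t)"
    using u v \<psi> x uA vB by (auto intro!: kantorovich_abs_le continuous_intros)
  then have "\<bar>?K u * ?K v\<bar> \<le> (A * ?K \<psi>) * (B * ?K \<psi>)"
    unfolding abs_mult kantorovich_cmult by (intro mult_mono) auto
  also have "\<dots> = (A * B) * (?K \<psi>)\<^sup>2" by (simp add: power2_eq_square mult_ac)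
  also have "\<dots> \<le> (A * B) * ?K (\<lambda>t. (\<psi> t)\<^sup>2)"
    using A B by (intro mult_left_mono kantorovich_power2_le \<psi> x) auto
  finally show ?thesis using 1 unfolding kantorovich_cov_def by linarith
qed

lemma kantorovich_cov_id_id:
  assumes n: "n \<ge> 1" and x: "x \<in> {0..1}"
  shows "\<bar>kantorovich_cov n x (\<lambda>t. t - x) (\<lambda>t. t - x) - x * (1 - x) / n\<bar> \<le> 1 / (real n)\<^sup>2"
proof -
  define X a N m where "X = x * (1 - x)" and "a = 1 / 2 - x" and "N = real n + 1" and "m = real n"
  have m: "1 \<le> m" "m \<le> N" "N = m + 1" using n by (simp_all add: m_def N_def)
  have X: "0 \<le> X" "X \<le> 1 / 4"
    using x sum_squares_bound[of x "1/2"] by (auto simp: X_def power2_eq_square algebra_simps mult_left_le)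
  note K = kantorovich_central_moments[of n x, folded X_def a_def N_def m_def]
  have "kantorovich_cov n x (\<lambda>t. t - x) (\<lambda>t. t - x) = (m * X + 1 / 12) / N\<^sup>2"
    using K(1,2) by (simp add: kantorovich_cov_def power2_eq_square add_divide_distrib)
  moreover have "(m * X + 1 / 12) / N\<^sup>2 - X / m = (m / 12 - X * (2 * m + 1)) / (m * N\<^sup>2)"
    using m by (simp add: divide_simps power2_eq_square) (simp add: algebra_simps)
  moreover have num: "\<bar>m / 12 - X * (2 * m + 1)\<bar> \<le> m"
  proof -
    have "0 \<le> X * (2 * m + 1)" "X * (2 * m + 1) \<le> 1 / 4 * (2 * m + 1)"
      using X m by (auto intro!: mult_right_mono)
    moreover have "\<bar>m / 12 - P\<bar> \<le> m" if "0 \<le> P" "P \<le> 1 / 4 * (2 * m + 1)" for P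
      using that m unfolding abs_le_iff by auto
    ultimately show ?thesis by blast
  qed
  moreover have "\<bar>(m / 12 - X * (2 * m + 1)) / (m * N\<^sup>2)\<bar> \<le> m / (m * N\<^sup>2)"
  proof -
    have pos: "\<bar>m * N\<^sup>2\<bar> = m * N\<^sup>2" using m by simp
    show ?thesis unfolding abs_divide pos using num m by (intro divide_right_mono) auto
  qed
  moreover have "m / (m * N\<^sup>2) \<le> 1 / m\<^sup>2" using m by (simp add: frac_le power_mono)
  ultimately show ?thesis by (simp add: X_def m_def)
qed

text \<open>
  This is where cancellation is used: the third central moment and the product of bias and second
  moment are both \<open>O(1 / n\<^sup>2)\<close>, one order of \<open>sqrt n\<close> better than the third absolute moment.
\<close>

lemma kantorovich_cov_id_square:
  assumes n: "n \<ge> 1" and x: "x \<in> {0..1}"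
  shows "\<bar>kantorovich_cov n x (\<lambda>t. t - x) (\<lambda>t. (t - x)\<^sup>2)\<bar> \<le> 1 / (real n)\<^sup>2"
proof -
  define X a N m where "X = x * (1 - x)" and "a = 1 / 2 - x" and "N = real n + 1" and "m = real n"
  have m: "1 \<le> m" "m \<le> N" "N = m + 1" using n by (simp_all add: m_def N_def)
  have X: "0 \<le> X" "X \<le> 1 / 4"
    using x sum_squares_bound[of x "1/2"] by (auto simp: X_def power2_eq_square algebra_simps mult_left_le)
  have a: "\<bar>a\<bar> \<le> 1 / 2" using x unfolding a_def abs_le_iff by auto
  note K = kantorovich_central_moments[of n x, folded X_def a_def N_def m_def]
  have "(\<lambda>t. (t - x) * (t - x)\<^sup>2) = (\<lambda>t. (t - x) ^ 3)"
    by (simp add: power2_eq_square power3_eq_cube mult.assoc)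
  then have "kantorovich_cov n x (\<lambda>t. t - x) (\<lambda>t. (t - x)\<^sup>2)
      = (5 * a * m * X + a ^ 3 + a / 4) / N ^ 3 - a / N * ((m * X + a\<^sup>2 + 1 / 12) / N\<^sup>2)"
    using K(1-3) by (simp add: kantorovich_cov_def)
  also have "\<dots> = a * (4 * (m * X) + 1 / 6) / N ^ 3"
    using m by (simp add: divide_simps) (simp add: algebra_simps power2_eq_square power3_eq_cube)
  finally have eq: "kantorovich_cov n x (\<lambda>t. t - x) (\<lambda>t. (t - x)\<^sup>2) = a * (4 * (m * X) + 1 / 6) / N ^ 3" .
  have "\<bar>4 * (m * X) + 1 / 6\<bar> \<le> 2 * m"
  proof -
    have "0 \<le> m * X" "m * X \<le> m * (1 / 4)" using X m by (auto intro!: mult_left_mono)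
    then show ?thesis using m unfolding abs_le_iff by linarith
  qed
  then have "\<bar>a\<bar> * \<bar>4 * (m * X) + 1 / 6\<bar> \<le> 1 / 2 * (2 * m)"
    using a by (intro mult_mono) auto
  also have "\<dots> \<le> N" using m by simp
  finally have "\<bar>a * (4 * (m * X) + 1 / 6) / N ^ 3\<bar> \<le> N / N ^ 3"
    using m by (simp add: abs_mult divide_right_mono)
  also have "\<dots> = 1 / N\<^sup>2" using m by (simp add: power2_eq_square power3_eq_cube)
  also have "\<dots> \<le> 1 / m\<^sup>2" using m by (simp add: frac_le power_mono)
  finally show ?thesis unfolding eq m_def .
qed

text \<open>
  The product \<open>K e * K R\<close> is harmless because the bias \<open>K e\<close> is \<open>O(1 / n)\<close>; a crude bound for \<open>R\<close>
  then suffices. In \<open>K (e * R)\<close> only the second and fourth moments occur.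
\<close>

lemma kantorovich_cov_id_remainder:
  assumes n: "n \<ge> 1" and x: "x \<in> {0..1}" and W: "0 \<le> W" and M: "0 \<le> M"
    and R: "continuous_on {0..1} R"
    and RWM: "\<And>t. t \<in> {0..1} \<Longrightarrow> \<bar>R t\<bar> \<le> W * \<bar>t - x\<bar> + M * \<bar>t - x\<bar> ^ 3"
  shows "\<bar>kantorovich_cov n x (\<lambda>t. t - x) R\<bar> \<le> 4 * (W / n + M / (real n)\<^sup>2)"
proof -
  let ?K = "\<lambda>f. kantorovich n f x"
  note mom = kantorovich_central_moment_bounds[OF n x]
  have add: "?K (\<lambda>t. c * u t + d * v t) = c * ?K u + d * ?K v"
    if "continuous_on {0..1} u" "continuous_on {0..1} v" for c d u v
    by (simp only: kantorovich_add[OF continuous_on_mult_left[OF that(1)] continuous_on_mult_left[OF that(2)]]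
        kantorovich_cmult)
  have "\<bar>?K (\<lambda>t. (t - x) * R t)\<bar> \<le> ?K (\<lambda>t. W * (t - x)\<^sup>2 + M * (t - x) ^ 4)"
  proof (rule kantorovich_abs_le)
    fix t :: real assume "t \<in> {0..1}"
    then have "\<bar>(t - x) * R t\<bar> \<le> \<bar>t - x\<bar> * (W * \<bar>t - x\<bar> + M * \<bar>t - x\<bar> ^ 3)"
      unfolding abs_mult by (intro mult_left_mono RWM) auto
    also have "\<dots> = W * \<bar>t - x\<bar> ^ 2 + M * \<bar>t - x\<bar> ^ 4"
      by (simp add: power2_eq_square power3_eq_cube power4_eq_xxxx algebra_simps del: abs_mult_self_eq)
    finally show "\<bar>(t - x) * R t\<bar> \<le> W * (t - x)\<^sup>2 + M * (t - x) ^ 4" by simp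
  qed (intro continuous_intros R x)+
  also have "\<dots> = W * ?K (\<lambda>t. (t - x)\<^sup>2) + M * ?K (\<lambda>t. (t - x) ^ 4)"
    by (intro add continuous_intros)
  also have "\<dots> \<le> W * (1 / n) + M * (3 / (real n)\<^sup>2)"
    using mom W M by (intro add_mono mult_left_mono) auto
  finally have 1: "\<bar>?K (\<lambda>t. (t - x) * R t)\<bar> \<le> W * (1 / n) + M * (3 / (real n)\<^sup>2)" .
  have "\<bar>?K R\<bar> \<le> ?K (\<lambda>t. W * 1 + M * (t - x)\<^sup>2)"
  proof (rule kantorovich_abs_le)
    fix t :: real assume t: "t \<in> {0..1}"
    then have "\<bar>t - x\<bar> \<le> 1" using x by auto
    moreover from this have "\<bar>t - x\<bar> ^ 3 \<le> \<bar>t - x\<bar> ^ 2" by (intro power_decreasing) auto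
    ultimately have "W * \<bar>t - x\<bar> + M * \<bar>t - x\<bar> ^ 3 \<le> W * 1 + M * \<bar>t - x\<bar> ^ 2"
      using W M by (intro add_mono mult_left_mono) auto
    then show "\<bar>R t\<bar> \<le> W * 1 + M * (t - x)\<^sup>2" using RWM[OF t] by simp
  qed (intro continuous_intros R x)+
  also have "\<dots> = W * ?K (\<lambda>t. 1) + M * ?K (\<lambda>t. (t - x)\<^sup>2)"
    by (intro add continuous_intros)
  also have "\<dots> \<le> W * 1 + M * (1 / n)"
    using mom W M by (intro add_mono mult_left_mono) (auto simp: kantorovich_const)
  finally have "\<bar>?K R\<bar> \<le> W * 1 + M * (1 / n)" .
  then have "\<bar>?K (\<lambda>t. t - x) * ?K R\<bar> \<le> 1 / (2 * n) * (W * 1 + M * (1 / n))"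
    unfolding abs_mult using mom(1) by (intro mult_mono) auto
  also have "\<dots> = (1 / 2) * (W / n) + (1 / 2) * (M / (real n)\<^sup>2)"
    by (simp add: power2_eq_square add_divide_distrib mult_ac)
  finally have 2: "\<bar>?K (\<lambda>t. t - x) * ?K R\<bar> \<le> (1 / 2) * (W / n) + (1 / 2) * (M / (real n)\<^sup>2)" .
  have "W * (1 / n) + M * (3 / (real n)\<^sup>2) = W / n + 3 * (M / (real n)\<^sup>2)" by simp
  moreover have "0 \<le> W / n" "0 \<le> M / (real n)\<^sup>2" using W M by simp_all
  ultimately show ?thesis using 1 2 unfolding kantorovich_cov_def by (simp add: abs_le_iff)
qed

text \<open>
  The derivative of the remainder is the error of the linear approximation to \<open>f'\<close>; the mean value
  inequality on the segment from \<open>x\<close> to \<open>t\<close> does the rest.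
\<close>

lemma quadratic_remainder_bound:
  fixes f f' :: "real \<Rightarrow> real"
  assumes f: "\<And>t. t \<in> {0..1} \<Longrightarrow> (f has_real_derivative f' t) (at t within {0..1})"
    and x: "x \<in> {0..1}" and t: "t \<in> {0..1}" and W: "0 \<le> W" and M: "0 \<le> M"
    and b: "\<And>t. t \<in> {0..1} \<Longrightarrow> \<bar>f' t - f' x - b * (t - x)\<bar> \<le> W + M * (t - x)\<^sup>2"
  shows "\<bar>f t - f x - f' x * (t - x) - b / 2 * (t - x)\<^sup>2\<bar> \<le> W * \<bar>t - x\<bar> + M * \<bar>t - x\<bar> ^ 3"
proof -
  let ?R = "\<lambda>s. f s - f' x * (s - x) - b / 2 * (s - x)\<^sup>2"
  have sub: "closed_segment x t \<subseteq> {0..1}"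
    using x t by (auto simp: closed_segment_eq_real_ivl)
  have "norm (?R t - ?R x) \<le> (W + M * \<bar>t - x\<bar>\<^sup>2) * norm (t - x)"
  proof (rule field_differentiable_bound[of "closed_segment x t"])
    fix z assume z: "z \<in> closed_segment x t"
    with sub have z01: "z \<in> {0..1}" by blast
    have "(f has_real_derivative f' z) (at z within closed_segment x t)"
      using f[OF z01] sub by (rule DERIV_subset)
    then show "(?R has_field_derivative f' z - f' x - b * (z - x)) (at z within closed_segment x t)"
      by (auto intro!: derivative_eq_intros)
    have "\<bar>z - x\<bar> \<le> \<bar>t - x\<bar>"
      using z by (auto simp: closed_segment_eq_real_ivl split: if_splits)
    then have "(z - x)\<^sup>2 \<le> \<bar>t - x\<bar>\<^sup>2" by (simp add: abs_le_square_iff)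
    then show "norm (f' z - f' x - b * (z - x)) \<le> W + M * \<bar>t - x\<bar>\<^sup>2"
      using b[OF z01] mult_left_mono[OF _ M, of "(z - x)\<^sup>2" "\<bar>t - x\<bar>\<^sup>2"] by simp
  qed auto
  then show ?thesis
    by (simp add: algebra_simps power2_eq_square power3_eq_cube del: abs_mult_self_eq)
qed

text \<open>
  The four terms on the right correspond to \<open>cov e e\<close>, \<open>cov e T\<close>, \<open>cov e S\<close> and \<open>cov S T\<close>, where \<open>S\<close>
  and \<open>T\<close> are the remainders of first order of \<open>f\<close> and \<open>g\<close> at \<open>x\<close>.
\<close>

lemma kantorovich_cov_estimate:
  assumes n: "n \<ge> 1" and x: "x \<in> {0..1}"
    and f: "C1_01_with_deriv f f'" and g: "C1_01_with_deriv g g'"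
    and Wf: "0 \<le> W\<^sub>f" and Mf: "0 \<le> M\<^sub>f" and Wg: "0 \<le> W\<^sub>g" and Mg: "0 \<le> M\<^sub>g"
    and bf: "\<bar>b\<^sub>f\<bar> \<le> M\<^sub>f" and bg: "\<bar>b\<^sub>g\<bar> \<le> M\<^sub>g"
    and linf: "\<And>t. t \<in> {0..1} \<Longrightarrow> \<bar>f' t - f' x - b\<^sub>f * (t - x)\<bar> \<le> W\<^sub>f + M\<^sub>f * (t - x)\<^sup>2"
    and ling: "\<And>t. t \<in> {0..1} \<Longrightarrow> \<bar>g' t - g' x - b\<^sub>g * (t - x)\<bar> \<le> W\<^sub>g + M\<^sub>g * (t - x)\<^sup>2"
  shows "\<bar>kantorovich_cov n x f g - x * (1 - x) / n * (f' x * g' x)\<bar>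
    \<le> \<bar>f' x * g' x\<bar> / (real n)\<^sup>2
      + 5 * \<bar>f' x\<bar> * (W\<^sub>g / n + M\<^sub>g / (real n)\<^sup>2) + 5 * \<bar>g' x\<bar> * (W\<^sub>f / n + M\<^sub>f / (real n)\<^sup>2)
      + 64 * (W\<^sub>f + M\<^sub>f / sqrt n) * (W\<^sub>g + M\<^sub>g / sqrt n) / n"
proof -
  let ?e = "\<lambda>t. t - x"
  \<comment> \<open>The common majorant of both remainders: \<open>W |e| + M e\<^sup>2\<close> is at most \<open>(W + M / sqrt n) * \<psi>\<close>,
    and the mean of \<open>\<psi>\<^sup>2\<close> is \<open>O(1 / n)\<close>, since both of its terms have mean square of that order.\<close>
  define \<psi> where "\<psi> t = \<bar>t - x\<bar> + sqrt n * (t - x)\<^sup>2" for t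
  note mom = kantorovich_central_moment_bounds[OF n x]
  have split: "\<exists>S. continuous_on {0..1} S \<and> (\<forall>t\<in>{0..1}. h t = h x + h' x * (t - x) + S t)
      \<and> \<bar>kantorovich_cov n x ?e S\<bar> \<le> 5 * (W / n + M / (real n)\<^sup>2)
      \<and> (\<forall>t\<in>{0..1}. \<bar>S t\<bar> \<le> 2 * (W + M / sqrt n) * \<psi> t)"
    if h: "C1_01_with_deriv h h'" and W: "0 \<le> W" and M: "0 \<le> M" and b: "\<bar>b\<bar> \<le> M"
      and lin: "\<forall>t\<in>{0..1}. \<bar>h' t - h' x - b * (t - x)\<bar> \<le> W + M * (t - x)\<^sup>2"
    for h h' W M b
  proof -
    define R where "R t = h t - h x - h' x * (t - x) - b / 2 * (t - x)\<^sup>2" for t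
    define S where "S t = h t - h x - h' x * (t - x)" for t
    have der: "(h has_real_derivative h' t) (at t within {0..1})" if "t \<in> {0..1}" for t
      using h that by (simp add: C1_01_with_deriv_def)
    have conth: "continuous_on {0..1} h" using der by (rule DERIV_continuous_on)
    have contR: "continuous_on {0..1} R" unfolding R_def by (intro continuous_on_diff continuous_on_mult continuous_intros conth) simp
    have contS: "continuous_on {0..1} S" unfolding S_def by (intro continuous_intros conth)
    have R: "\<bar>R t\<bar> \<le> W * \<bar>t - x\<bar> + M * \<bar>t - x\<bar> ^ 3" if "t \<in> {0..1}" for t
      unfolding R_def by (rule quadratic_remainder_bound[OF der x that W M bspec[OF lin]])
    have "kantorovich_cov n x S ?e = b / 2 * kantorovich_cov n x (\<lambda>t. (t - x)\<^sup>2) ?e + kantorovich_cov n x R ?e"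
      by (rule kantorovich_cov_affine[where c = 0, OF _ _ contR])
         (auto simp: S_def R_def intro!: continuous_intros)
    then have "kantorovich_cov n x ?e S = b / 2 * kantorovich_cov n x ?e (\<lambda>t. (t - x)\<^sup>2) + kantorovich_cov n x ?e R"
      by (simp only: kantorovich_cov_commute[of n x _ ?e])
    moreover have "\<bar>b / 2 * kantorovich_cov n x ?e (\<lambda>t. (t - x)\<^sup>2)\<bar> \<le> M * (1 / (real n)\<^sup>2)"
      unfolding abs_mult using kantorovich_cov_id_square[OF n x] b by (intro mult_mono) auto
    moreover have "\<bar>kantorovich_cov n x ?e R\<bar> \<le> 4 * (W / n + M / (real n)\<^sup>2)"
      by (rule kantorovich_cov_id_remainder[OF n x W M contR R])
    moreover have "0 \<le> W / n" using W by simp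
    ultimately have "\<bar>kantorovich_cov n x ?e S\<bar> \<le> 5 * (W / n + M / (real n)\<^sup>2)" by (simp add: abs_le_iff)
    moreover have "\<bar>S t\<bar> \<le> 2 * (W + M / sqrt n) * \<psi> t" if t: "t \<in> {0..1}" for t
    proof -
      have "\<bar>t - x\<bar> ^ 3 \<le> \<bar>t - x\<bar> ^ 2" using x t by (intro power_decreasing) auto
      then have "M * \<bar>t - x\<bar> ^ 3 \<le> M * (t - x)\<^sup>2" using M by (simp add: mult_left_mono)
      moreover have "\<bar>b / 2 * (t - x)\<^sup>2\<bar> \<le> M * (t - x)\<^sup>2"
        unfolding abs_mult using b by (intro mult_mono) auto
      moreover have "S t = R t + b / 2 * (t - x)\<^sup>2" by (simp add: S_def R_def)
      ultimately have "\<bar>S t\<bar> \<le> W * \<bar>t - x\<bar> + 2 * (M * (t - x)\<^sup>2)"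
        using R[OF t] by linarith
      also have "M * (t - x)\<^sup>2 = M / sqrt n * (sqrt n * (t - x)\<^sup>2)" using n by simp
      also have "W * \<bar>t - x\<bar> + 2 * (M / sqrt n * (sqrt n * (t - x)\<^sup>2)) \<le> 2 * (W + M / sqrt n) * \<psi> t"
      proof -
        have "0 \<le> W * \<bar>t - x\<bar>" "0 \<le> W * (sqrt n * (t - x)\<^sup>2)" "0 \<le> M / sqrt n * \<bar>t - x\<bar>"
          using W M by simp_all
        then show ?thesis unfolding \<psi>_def by (simp add: distrib_left distrib_right)
      qed
      finally show ?thesis .
    qed
    ultimately show ?thesis using contS by (intro exI[of _ S]) (auto simp: S_def)
  qed
  have linf_all: "\<forall>t\<in>{0..1}. \<bar>f' t - f' x - b\<^sub>f * (t - x)\<bar> \<le> W\<^sub>f + M\<^sub>f * (t - x)\<^sup>2"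
    and ling_all: "\<forall>t\<in>{0..1}. \<bar>g' t - g' x - b\<^sub>g * (t - x)\<bar> \<le> W\<^sub>g + M\<^sub>g * (t - x)\<^sup>2"
    using linf ling by blast+
  obtain S where S: "continuous_on {0..1} S" "\<forall>t\<in>{0..1}. f t = f x + f' x * (t - x) + S t"
      "\<bar>kantorovich_cov n x ?e S\<bar> \<le> 5 * (W\<^sub>f / n + M\<^sub>f / (real n)\<^sup>2)"
      "\<forall>t\<in>{0..1}. \<bar>S t\<bar> \<le> 2 * (W\<^sub>f + M\<^sub>f / sqrt n) * \<psi> t"
    using split[OF f Wf Mf bf linf_all] by (elim exE conjE) (rule that)
  obtain T where T: "continuous_on {0..1} T" "\<forall>t\<in>{0..1}. g t = g x + g' x * (t - x) + T t"
      "\<bar>kantorovich_cov n x ?e T\<bar> \<le> 5 * (W\<^sub>g / n + M\<^sub>g / (real n)\<^sup>2)"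
      "\<forall>t\<in>{0..1}. \<bar>T t\<bar> \<le> 2 * (W\<^sub>g + M\<^sub>g / sqrt n) * \<psi> t"
    using split[OF g Wg Mg bg ling_all] by (elim exE conjE) (rule that)
  have conte: "continuous_on {0..1} ?e" by (intro continuous_intros)
  have contg: "continuous_on {0..1} g"
    using g DERIV_continuous_on[of "{0..1}" g g'] by (simp add: C1_01_with_deriv_def)
  have expand: "kantorovich_cov n x f g = f' x * (g' x * kantorovich_cov n x ?e ?e + kantorovich_cov n x ?e T)
      + (g' x * kantorovich_cov n x ?e S + kantorovich_cov n x S T)"
  proof -
    have left: "kantorovich_cov n x f g = f' x * kantorovich_cov n x ?e g + kantorovich_cov n x S g"
      by (rule kantorovich_cov_affine[OF bspec[OF S(2)] conte S(1) contg])
    have right: "kantorovich_cov n x g v = g' x * kantorovich_cov n x ?e v + kantorovich_cov n x T v"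
      if "continuous_on {0..1} v" for v
      by (rule kantorovich_cov_affine[OF bspec[OF T(2)] conte T(1) that])
    show ?thesis
      using left right[OF conte] right[OF S(1)] by (simp only: kantorovich_cov_commute[of n x g]
        kantorovich_cov_commute[of n x T])
  qed
  have cont\<psi>: "continuous_on {0..1} \<psi>" unfolding \<psi>_def by (intro continuous_intros)
  have "kantorovich n (\<lambda>t. (\<psi> t)\<^sup>2) x \<le> kantorovich n (\<lambda>t. 2 * (t - x)\<^sup>2 + 2 * n * (t - x) ^ 4) x"
  proof (intro kantorovich_mono continuous_intros cont\<psi> x)
    fix t :: real
    have "(\<psi> t)\<^sup>2 \<le> 2 * \<bar>t - x\<bar>\<^sup>2 + 2 * (sqrt n * (t - x)\<^sup>2)\<^sup>2"
      unfolding \<psi>_def using sum_squares_bound[of "\<bar>t - x\<bar>" "sqrt n * (t - x)\<^sup>2"]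
      by (simp add: power2_sum)
    then show "(\<psi> t)\<^sup>2 \<le> 2 * (t - x)\<^sup>2 + 2 * n * (t - x) ^ 4"
      by (simp add: power_mult_distrib flip: power_mult)
  qed
  also have "\<dots> = 2 * kantorovich n (\<lambda>t. (t - x)\<^sup>2) x + 2 * n * kantorovich n (\<lambda>t. (t - x) ^ 4) x"
  proof -
    have c: "continuous_on {0..1} (\<lambda>t. 2 * (t - x)\<^sup>2)" "continuous_on {0..1} (\<lambda>t. 2 * n * (t - x) ^ 4)"
      by (intro continuous_intros)+
    show ?thesis unfolding kantorovich_add[OF c] kantorovich_cmult ..
  qed
  also have "\<dots> \<le> 2 * (1 / n) + 2 * n * (3 / n\<^sup>2)"
    using mom by (intro add_mono mult_left_mono) auto
  also have "\<dots> = 8 / n" using n by (simp add: power2_eq_square)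
  finally have \<psi>2: "kantorovich n (\<lambda>t. (\<psi> t)\<^sup>2) x \<le> 8 / n" .
  have "\<bar>kantorovich_cov n x S T\<bar>
      \<le> 2 * (2 * (W\<^sub>f + M\<^sub>f / sqrt n) * (2 * (W\<^sub>g + M\<^sub>g / sqrt n))) * kantorovich n (\<lambda>t. (\<psi> t)\<^sup>2) x"
    using Wf Mf Wg Mg by (intro kantorovich_cov_dominated S(1) T(1) bspec[OF S(4)] bspec[OF T(4)] cont\<psi> x) auto
  also have "\<dots> \<le> 2 * (2 * (W\<^sub>f + M\<^sub>f / sqrt n) * (2 * (W\<^sub>g + M\<^sub>g / sqrt n))) * (8 / n)"
    using Wf Mf Wg Mg by (intro mult_left_mono \<psi>2) auto
  also have "\<dots> = 64 * (W\<^sub>f + M\<^sub>f / sqrt n) * (W\<^sub>g + M\<^sub>g / sqrt n) / n"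
  proof -
    have "2 * (2 * a * (2 * b)) * (8 / n) = 64 * a * b / n" for a b :: real by simp
    then show ?thesis .
  qed
  finally have ST: "\<bar>kantorovich_cov n x S T\<bar> \<le> 64 * (W\<^sub>f + M\<^sub>f / sqrt n) * (W\<^sub>g + M\<^sub>g / sqrt n) / n" .
  have main: "\<bar>f' x * g' x * (kantorovich_cov n x ?e ?e - x * (1 - x) / n)\<bar> \<le> \<bar>f' x * g' x\<bar> * (1 / (real n)\<^sup>2)"
    unfolding abs_mult[of "f' x * g' x"] using kantorovich_cov_id_id[OF n x] by (intro mult_left_mono) auto
  have eT: "\<bar>f' x * kantorovich_cov n x ?e T\<bar> \<le> \<bar>f' x\<bar> * (5 * (W\<^sub>g / n + M\<^sub>g / (real n)\<^sup>2))"
    unfolding abs_mult using T(3) by (intro mult_left_mono) auto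
  have eS: "\<bar>g' x * kantorovich_cov n x ?e S\<bar> \<le> \<bar>g' x\<bar> * (5 * (W\<^sub>f / n + M\<^sub>f / (real n)\<^sup>2))"
    unfolding abs_mult using S(3) by (intro mult_left_mono) auto
  have sum: "kantorovich_cov n x f g - x * (1 - x) / n * (f' x * g' x)
      = f' x * g' x * (kantorovich_cov n x ?e ?e - x * (1 - x) / n) + f' x * kantorovich_cov n x ?e T
        + g' x * kantorovich_cov n x ?e S + kantorovich_cov n x S T"
    unfolding expand by (simp add: algebra_simps)
  have triangle: "\<bar>u + v + w + z\<bar> \<le> a + b + c + d"
    if "\<bar>u\<bar> \<le> a" "\<bar>v\<bar> \<le> b" "\<bar>w\<bar> \<le> c" "\<bar>z\<bar> \<le> d" for u v w z a b c d :: real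
    using that by linarith
  show ?thesis unfolding sum
    using main eT eS by (intro triangle ST) (simp_all add: mult_ac)
qed

section \<open>The modulus of smoothness and the quantitative estimate\<close>

lemma abs_le_sup_norm01:
  assumes "continuous_on {0..1} \<phi>" "t \<in> {0..1}"
  shows "\<bar>\<phi> t\<bar> \<le> sup_norm01 \<phi>"
proof -
  have "compact ((\<lambda>t. \<bar>\<phi> t\<bar>) ` {0..1})"
    by (intro compact_continuous_image continuous_intros assms(1)) simp
  then have "bdd_above ((\<lambda>t. \<bar>\<phi> t\<bar>) ` {0..1})" by (intro bounded_imp_bdd_above compact_imp_bounded)
  then show ?thesis unfolding sup_norm01_def using assms(2) by (intro cSUP_upper)
qed

lemma third_difference_le_modulus:
  assumes cont: "continuous_on {0..1} \<phi>" and "0 \<le> s" "s \<le> h" "0 \<le> y" "y + 3 * s \<le> 1"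
  shows "\<bar>third_difference \<phi> s y\<bar> \<le> modulus_of_smoothness 3 \<phi> h"
proof -
  have td: "(\<Sum>j\<le>3. (- 1) ^ (3 - j) * real (3 choose j) * \<phi> (y + real j * d)) = third_difference \<phi> d y" for d y
    by (simp add: numeral_eq_Suc third_difference_def)
  have "bdd_above {\<bar>third_difference \<phi> d y\<bar> | y d. 0 \<le> d \<and> d \<le> h \<and> y \<in> {0..1} \<and> y + real 3 * d \<in> {0..1}}"
  proof (intro bdd_aboveI[of _ "8 * sup_norm01 \<phi>"], clarify)
    fix y d :: real assume "0 \<le> d" "d \<le> h" "y \<in> {0..1}" "y + real 3 * d \<in> {0..1}"
    then have "{y, y + d, y + 2 * d, y + 3 * d} \<subseteq> {0..1}" by auto
    then show "\<bar>third_difference \<phi> d y\<bar> \<le> 8 * sup_norm01 \<phi>"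
      using abs_le_sup_norm01[OF cont, of y] abs_le_sup_norm01[OF cont, of "y + d"]
        abs_le_sup_norm01[OF cont, of "y + 2 * d"] abs_le_sup_norm01[OF cont, of "y + 3 * d"]
      unfolding third_difference_def by simp
  qed
  then show ?thesis unfolding modulus_of_smoothness_def td
    by (rule cSup_upper[rotated]) (use assms in fastforce)
qed

theorem theorem5p2:
  shows "\<exists>C::real. \<forall>(f::real \<Rightarrow> real) f' g g' (n::nat).
    C1_01_with_deriv f f' \<longrightarrow> C1_01_with_deriv g g' \<longrightarrow> n \<ge> 1 \<longrightarrow>
    sup_norm01 (\<lambda>x. kantorovich n (\<lambda>t. f t * g t) x - kantorovich n f x * kantorovich n g x
                    - x * (1 - x) / real n * (f' x * g' x))
    \<le> C / real n *
       (modulus_of_smoothness 3 f' (real n powr (- 1 / 6))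
          * modulus_of_smoothness 3 g' (real n powr (- 1 / 6))
        + sup_norm01 f' * modulus_of_smoothness 3 g' (real n powr (- 1 / 6))
        + sup_norm01 g' * modulus_of_smoothness 3 f' (real n powr (- 1 / 6))
        + max (sup_norm01 f' / real n powr (1 / 2))
              (modulus_of_smoothness 3 f' (real n powr (- 1 / 6)))
          * max (sup_norm01 g' / real n powr (1 / 2))
                (modulus_of_smoothness 3 g' (real n powr (- 1 / 6))))"
proof -
  \<comment> \<open>\<open>c\<close> is the constant of the local linear approximation. In \<open>C\<close> the summand \<open>1\<close> comes from the
    error in the main term, \<open>10 * c\<close> from the two mixed covariances, and \<open>576 * c\<^sup>2 = 64 * (3 * c)\<^sup>2\<close> from the
    covariance of the remainders.\<close>
  define c :: real where "c = 3200000"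
  have c: "1 \<le> c" by (simp add: c_def)
  define C where "C = 1 + 10 * c + 576 * c\<^sup>2"
  have C: "10 * c \<le> C" "0 \<le> C" using c by (simp_all add: C_def)
  show ?thesis
  proof (intro exI[of _ C] allI impI)
    fix f f' g g' :: "real \<Rightarrow> real" and n :: nat
    assume f: "C1_01_with_deriv f f'" and g: "C1_01_with_deriv g g'" and n: "n \<ge> 1"
    \<comment> \<open>The step is chosen such that \<open>1 / h ^ 3 = sqrt n\<close>.\<close>
    define h where "h = real n powr (- 1 / 6)"
    define W\<^sub>f W\<^sub>g where "W\<^sub>f = modulus_of_smoothness 3 f' h" and "W\<^sub>g = modulus_of_smoothness 3 g' h"
    define m\<^sub>f m\<^sub>g where "m\<^sub>f = sup_norm01 f'" and "m\<^sub>g = sup_norm01 g'"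
    define r where "r = sqrt n"
    have r: "1 \<le> r" "r * r = n" using n by (simp_all add: r_def)
    have powr_half: "real n powr (1 / 2) = r" by (simp add: r_def powr_half_sqrt)
    have h: "0 < h" "h \<le> 1" using n powr_mono[of "- 1 / 6" 0 "real n"] by (auto simp: h_def)
    have "h ^ 3 = real n powr (- (1 / 2))"
      using n by (simp add: h_def powr_power)
    then have h3: "h ^ 3 = 1 / r" unfolding powr_minus powr_half by (simp add: inverse_eq_divide)
    have cf: "continuous_on {0..1} f'" and cg: "continuous_on {0..1} g'"
      using f g by (simp_all add: C1_01_with_deriv_def)
    have lin: "\<exists>b. \<bar>b\<bar> \<le> c * (sup_norm01 \<phi> + modulus_of_smoothness 3 \<phi> h * r) \<and>
        (\<forall>t\<in>{0..1}. \<bar>\<phi> t - \<phi> x - b * (t - x)\<bar> \<le> c * (modulus_of_smoothness 3 \<phi> h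
            + (sup_norm01 \<phi> + modulus_of_smoothness 3 \<phi> h * r) * (t - x)\<^sup>2))"
      if \<phi>: "continuous_on {0..1} \<phi>" and x: "x \<in> {0..1}" for \<phi> x
    proof -
      have scale: "modulus_of_smoothness 3 \<phi> h * r = modulus_of_smoothness 3 \<phi> h / h ^ 3"
        by (simp add: h3)
      show ?thesis unfolding c_def scale
        by (rule linear_approximation[OF \<phi> h])
           (use third_difference_le_modulus[OF \<phi>] abs_le_sup_norm01[OF \<phi>] x in auto)
    qed
    have W0: "0 \<le> W\<^sub>f" "0 \<le> W\<^sub>g"
      using third_difference_le_modulus[OF cf, of 0 h 0] third_difference_le_modulus[OF cg, of 0 h 0] h
      by (simp_all add: third_difference_def W\<^sub>f_def W\<^sub>g_def)
    have m0: "0 \<le> m\<^sub>f" "0 \<le> m\<^sub>g"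
      using abs_le_sup_norm01[OF cf, of 0] abs_le_sup_norm01[OF cg, of 0] by (simp_all add: m\<^sub>f_def m\<^sub>g_def)
    define a\<^sub>f a\<^sub>g where "a\<^sub>f = max (m\<^sub>f / r) W\<^sub>f" and "a\<^sub>g = max (m\<^sub>g / r) W\<^sub>g"
    have a: "m\<^sub>f / r \<le> a\<^sub>f" "W\<^sub>f \<le> a\<^sub>f" "m\<^sub>g / r \<le> a\<^sub>g" "W\<^sub>g \<le> a\<^sub>g"
      by (simp_all add: a\<^sub>f_def a\<^sub>g_def)
    have a0: "0 \<le> a\<^sub>f" "0 \<le> a\<^sub>g" using a W0 by simp_all
    define M\<^sub>f M\<^sub>g where "M\<^sub>f = m\<^sub>f + W\<^sub>f * r" and "M\<^sub>g = m\<^sub>g + W\<^sub>g * r"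
    have M0: "0 \<le> M\<^sub>f" "0 \<le> M\<^sub>g" using m0 W0 r by (simp_all add: M\<^sub>f_def M\<^sub>g_def)
    have pointwise: "\<bar>kantorovich_cov n x f g - x * (1 - x) / n * (f' x * g' x)\<bar>
        \<le> C / n * (W\<^sub>f * W\<^sub>g + m\<^sub>f * W\<^sub>g + m\<^sub>g * W\<^sub>f + a\<^sub>f * a\<^sub>g)" if x: "x \<in> {0..1}" for x
    proof -
      obtain b\<^sub>f where bf: "\<bar>b\<^sub>f\<bar> \<le> c * M\<^sub>f"
        and linf: "\<forall>t\<in>{0..1}. \<bar>f' t - f' x - b\<^sub>f * (t - x)\<bar> \<le> c * (W\<^sub>f + M\<^sub>f * (t - x)\<^sup>2)"
        using lin[OF cf x] unfolding W\<^sub>f_def[symmetric] m\<^sub>f_def[symmetric] M\<^sub>f_def[symmetric]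
        by (elim exE conjE) (rule that)
      obtain b\<^sub>g where bg: "\<bar>b\<^sub>g\<bar> \<le> c * M\<^sub>g"
        and ling: "\<forall>t\<in>{0..1}. \<bar>g' t - g' x - b\<^sub>g * (t - x)\<bar> \<le> c * (W\<^sub>g + M\<^sub>g * (t - x)\<^sup>2)"
        using lin[OF cg x] unfolding W\<^sub>g_def[symmetric] m\<^sub>g_def[symmetric] M\<^sub>g_def[symmetric]
        by (elim exE conjE) (rule that)
      have p: "\<bar>f' x\<bar> \<le> m\<^sub>f" "\<bar>g' x\<bar> \<le> m\<^sub>g"
        using abs_le_sup_norm01[OF cf x] abs_le_sup_norm01[OF cg x] by (simp_all add: m\<^sub>f_def m\<^sub>g_def)
      have main: "\<bar>kantorovich_cov n x f g - x * (1 - x) / n * (f' x * g' x)\<bar>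
        \<le> \<bar>f' x * g' x\<bar> / (real n)\<^sup>2
          + 5 * \<bar>f' x\<bar> * (c * W\<^sub>g / n + c * M\<^sub>g / (real n)\<^sup>2)
          + 5 * \<bar>g' x\<bar> * (c * W\<^sub>f / n + c * M\<^sub>f / (real n)\<^sup>2)
          + 64 * (c * W\<^sub>f + c * M\<^sub>f / sqrt n) * (c * W\<^sub>g + c * M\<^sub>g / sqrt n) / n"
        by (rule kantorovich_cov_estimate[OF n x f g _ _ _ _ bf bg])
           (use c W0 M0 linf ling in \<open>auto simp: algebra_simps\<close>)
      have mm: "m\<^sub>f * m\<^sub>g / (real n)\<^sup>2 \<le> a\<^sub>f * a\<^sub>g / n"
      proof -
        have "m\<^sub>f * m\<^sub>g / (real n)\<^sup>2 = (m\<^sub>f / r) * (m\<^sub>g / r) / n"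
          by (simp add: power2_eq_square flip: r(2))
        also have "\<dots> \<le> a\<^sub>f * a\<^sub>g / n"
          using a a0 m0 r by (intro divide_right_mono mult_mono) auto
        finally show ?thesis .
      qed
      \<comment> \<open>The part \<open>W * r / n\<^sup>2\<close> is absorbed by \<open>W / n\<close>, and the part with \<open>q * m / n\<^sup>2\<close> goes into
        the product of maxima.\<close>
      have cross: "5 * p * (c * W / n + c * (m + W * r) / (real n)\<^sup>2)
          \<le> 10 * c * (q * W / n) + 5 * c * (q * m / (real n)\<^sup>2)"
        if "0 \<le> p" "p \<le> q" "0 \<le> W" "0 \<le> m" for p q W m :: real
      proof -
        have "r \<le> n" using r mult_left_mono[of 1 r r] by simp
        then have "W * r / (real n)\<^sup>2 \<le> W * n / (real n)\<^sup>2"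
          using that by (intro divide_right_mono mult_left_mono) auto
        also have "\<dots> = W / n" using n by (simp add: power2_eq_square)
        finally have "c * W / n + c * (m + W * r) / (real n)\<^sup>2 \<le> c * (2 * (W / n) + m / (real n)\<^sup>2)"
          using c by (simp add: distrib_left add_divide_distrib mult_left_mono flip: times_divide_eq_right)
        then have "5 * p * (c * W / n + c * (m + W * r) / (real n)\<^sup>2)
            \<le> 5 * q * (c * (2 * (W / n) + m / (real n)\<^sup>2))"
          using that c r by (intro mult_mono) auto
        also have "\<dots> = 10 * c * (q * W / n) + 5 * c * (q * m / (real n)\<^sup>2)"
          by (simp add: algebra_simps)
        finally show ?thesis .
      qed
      have last: "c * W\<^sub>f + c * M\<^sub>f / sqrt n \<le> 3 * c * a\<^sub>f" "c * W\<^sub>g + c * M\<^sub>g / sqrt n \<le> 3 * c * a\<^sub>g"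
      proof -
        have "M\<^sub>f / r = m\<^sub>f / r + W\<^sub>f" "M\<^sub>g / r = m\<^sub>g / r + W\<^sub>g"
          using r by (simp_all add: M\<^sub>f_def M\<^sub>g_def add_divide_distrib)
        then have "c * (W\<^sub>f + M\<^sub>f / r) \<le> c * (3 * a\<^sub>f)" "c * (W\<^sub>g + M\<^sub>g / r) \<le> c * (3 * a\<^sub>g)"
          using a c by (auto intro!: mult_left_mono)
        then show "c * W\<^sub>f + c * M\<^sub>f / sqrt n \<le> 3 * c * a\<^sub>f" "c * W\<^sub>g + c * M\<^sub>g / sqrt n \<le> 3 * c * a\<^sub>g"
          by (simp_all add: r_def distrib_left)
      qed
      have "64 * (c * W\<^sub>f + c * M\<^sub>f / sqrt n) * (c * W\<^sub>g + c * M\<^sub>g / sqrt n) / n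
          \<le> 64 * (3 * c * a\<^sub>f) * (3 * c * a\<^sub>g) / n"
        using last a0 c W0 M0 by (intro divide_right_mono mult_mono) auto
      also have "\<dots> = 576 * c\<^sup>2 * (a\<^sub>f * a\<^sub>g / n)" by (simp add: power2_eq_square)
      finally have 4: "64 * (c * W\<^sub>f + c * M\<^sub>f / sqrt n) * (c * W\<^sub>g + c * M\<^sub>g / sqrt n) / n
          \<le> 576 * c\<^sup>2 * (a\<^sub>f * a\<^sub>g / n)" .
      have "\<bar>f' x * g' x\<bar> / (real n)\<^sup>2 \<le> m\<^sub>f * m\<^sub>g / (real n)\<^sup>2"
        unfolding abs_mult using p m0 by (intro divide_right_mono mult_mono) auto
      then have 1: "\<bar>f' x * g' x\<bar> / (real n)\<^sup>2 \<le> a\<^sub>f * a\<^sub>g / n" using mm by simp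
      have mm': "5 * c * (m\<^sub>f * m\<^sub>g / (real n)\<^sup>2) \<le> 5 * c * (a\<^sub>f * a\<^sub>g / n)"
        using mm c by (intro mult_left_mono) auto
      have 2: "5 * \<bar>f' x\<bar> * (c * W\<^sub>g / n + c * M\<^sub>g / (real n)\<^sup>2)
          \<le> 10 * c * (m\<^sub>f * W\<^sub>g / n) + 5 * c * (a\<^sub>f * a\<^sub>g / n)"
        using cross[of "\<bar>f' x\<bar>" m\<^sub>f W\<^sub>g m\<^sub>g] p m0 W0 mm' unfolding M\<^sub>g_def by simp
      have 3: "5 * \<bar>g' x\<bar> * (c * W\<^sub>f / n + c * M\<^sub>f / (real n)\<^sup>2)
          \<le> 10 * c * (m\<^sub>g * W\<^sub>f / n) + 5 * c * (a\<^sub>f * a\<^sub>g / n)"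
        using cross[of "\<bar>g' x\<bar>" m\<^sub>g W\<^sub>f m\<^sub>f] p m0 W0 mm' unfolding M\<^sub>f_def
        by (simp add: mult.commute[of m\<^sub>g m\<^sub>f])
      have "10 * c * (m\<^sub>f * W\<^sub>g / n) \<le> C * (m\<^sub>f * W\<^sub>g / n)" "10 * c * (m\<^sub>g * W\<^sub>f / n) \<le> C * (m\<^sub>g * W\<^sub>f / n)"
        using m0 W0 by (intro mult_right_mono C(1); simp)+
      moreover have "0 \<le> C * (W\<^sub>f * W\<^sub>g / n)"
        using W0 C by simp
      moreover have "C * (a\<^sub>f * a\<^sub>g / n)
          = a\<^sub>f * a\<^sub>g / n + 5 * c * (a\<^sub>f * a\<^sub>g / n) + 5 * c * (a\<^sub>f * a\<^sub>g / n) + 576 * c\<^sup>2 * (a\<^sub>f * a\<^sub>g / n)"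
        by (simp add: C_def algebra_simps)
      moreover have "C / n * (W\<^sub>f * W\<^sub>g + m\<^sub>f * W\<^sub>g + m\<^sub>g * W\<^sub>f + a\<^sub>f * a\<^sub>g)
          = C * (W\<^sub>f * W\<^sub>g / n) + C * (m\<^sub>f * W\<^sub>g / n) + C * (m\<^sub>g * W\<^sub>f / n) + C * (a\<^sub>f * a\<^sub>g / n)"
        by (simp add: distrib_left add_divide_distrib)
      ultimately show ?thesis using main 1 2 3 4 by linarith
    qed
    have "sup_norm01 (\<lambda>x. kantorovich_cov n x f g - x * (1 - x) / n * (f' x * g' x))
        \<le> C / n * (W\<^sub>f * W\<^sub>g + m\<^sub>f * W\<^sub>g + m\<^sub>g * W\<^sub>f + a\<^sub>f * a\<^sub>g)"
      unfolding sup_norm01_def by (intro cSUP_least pointwise) auto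
    then show "sup_norm01 (\<lambda>x. kantorovich n (\<lambda>t. f t * g t) x - kantorovich n f x * kantorovich n g x
                    - x * (1 - x) / real n * (f' x * g' x))
    \<le> C / real n *
       (modulus_of_smoothness 3 f' (real n powr (- 1 / 6))
          * modulus_of_smoothness 3 g' (real n powr (- 1 / 6))
        + sup_norm01 f' * modulus_of_smoothness 3 g' (real n powr (- 1 / 6))
        + sup_norm01 g' * modulus_of_smoothness 3 f' (real n powr (- 1 / 6))
        + max (sup_norm01 f' / real n powr (1 / 2))
              (modulus_of_smoothness 3 f' (real n powr (- 1 / 6)))
          * max (sup_norm01 g' / real n powr (1 / 2))
                (modulus_of_smoothness 3 g' (real n powr (- 1 / 6))))"
      unfolding kantorovich_cov_def W\<^sub>f_def W\<^sub>g_def m\<^sub>f_def m\<^sub>g_def a\<^sub>f_def a\<^sub>g_def powr_half h_def .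
  qed
qed

end
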